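(* Let $\varphi:\mathbb N\to\mathbb N_0$ be a function with $\varphi(d)\le d$ for all $d\in\mathbb N$. (a) If for some $\alpha\in[0,1)$ one has $\varphi(d)\in o(d^{1-\alpha})$ as $d\to\infty$, then $$q_L(\alpha,d,\varphi(d))\gtrsim\tfrac18\,d^{-1}\quad\text{as }d\to\infty .$$ (b) If for some $\alpha\in[0,1)$ and $c\in[0,1]$ one has $\varphi(d)\sim c\,d^{1-\alpha}$ as $d\to\infty$ (meaning $\varphi(d)/d^{1-\alpha}\to c$), then there exists a constant $C(c,\alpha)>0$, depending only on $c$ and $\alpha$, such that $$q_L(\alpha,d,\varphi(d))\gtrsim C(c,\alpha)\,d^{-1}\quad\text{as }d\to\infty .$$ (c) If for some $c\in(0,1]$ one has $\varphi(d)\sim c\,d$ as $d\to\infty$, then for every $\alpha\in(0,1)$, $$q_L(\alpha,d,\varphi(d))\gtrsim\tfrac14\,(1-\alpha)\,(cd)^{-\frac{1}{1-\alpha}}\quad\text{as }d\to\infty .$$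
   Context: Setting: site percolation on $\mathbb Z^{d+1}$. $\Omega=\{0,1\}^{\mathbb Z^{d+1}}$, and for $p\in[0,1]$, $\mathbb P_p$ is the product measure on $\Omega$ of Bernoulli distributions with parameter $p$. A site $x$ is open if $\omega(x)=1$ and closed if $\omega(x)=0$. A function $F:\mathbb Z^d\to\mathbb Z$ is Lipschitz if $|F(\bar x)-F(\bar y)|\le 1$ whenever $\Vert\bar x-\bar y\Vert_1=1$. For $\alpha\in[0,1)$ and $\eta\in\{-1,0,+1\}^d$, $\mathsf{LIP}^{\alpha,d}_\eta$ is the event of all $\omega\in\Omega$ for which there is a Lipschitz function $F$ such that for all $\bar x\in\mathbb Z^d$: $\omega((\bar x,F(\bar x)))=1$ and $F(\bar x)>\lfloor\alpha\sum_{i=1}^d\eta_i\bar x_i\rfloor$. Critical probability: there is a number $p_L(\alpha,d,\eta)\in(0,1)$ such that $\mathbb P_p(\mathsf{LIP}^{\alpha,d}_\eta)=0$ for $p<p_L(\alpha,d,\eta)$ and $=1$ for $p>p_L(\alpha,d,\eta)$; it depends on $\eta$ only through $k=\Vert\eta\Vert_1\in\{0,\dots,d\}$ and is written $p_L(\alpha,d,k)$. Put $q_L(\alpha,d,k):=1-p_L(\alpha,d,k)$. Notation: $\mathbb N=\{1,2,\dots\}$, $\mathbb N_0=\mathbb N\cup\{0\}$. $f(s)\gtrsim g(s)$ as $s\to\bar s$ means $\liminf_{s\to\bar s}f(s)/g(s)\ge1$; $f(s)\sim g(s)$ means $f(s)/g(s)\to1$. *)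

theory Defs
  imports "HOL-Probability.Probability" "HOL-Library.Landau_Symbols"
begin

text \<open>
  The dimension tends to infinity in the result, so it cannot be a type: the lattice of dimension
  \<open>n\<close> is the set of integer functions on \<open>{1..n}\<close> (extended by \<open>undefined\<close>).
\<close>

definition lattice_pts :: "nat \<Rightarrow> (nat \<Rightarrow> int) set" where
  "lattice_pts n = {1..n} \<rightarrow>\<^sub>E UNIV"

definition l1_norm :: "nat \<Rightarrow> (nat \<Rightarrow> int) \<Rightarrow> int" where
  "l1_norm n x = (\<Sum>i=1..n. \<bar>x i\<bar>)"

text \<open>Configurations are Boolean valued: \<open>\<omega> x\<close> means that the site \<open>x\<close> is open.\<close>

definition configs :: "nat \<Rightarrow> ((nat \<Rightarrow> int) \<Rightarrow> bool) set" where
  "configs n = lattice_pts n \<rightarrow>\<^sub>E UNIV"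

definition site_perc :: "nat \<Rightarrow> real \<Rightarrow> ((nat \<Rightarrow> int) \<Rightarrow> bool) measure" where
  "site_perc n p = PiM (lattice_pts n) (\<lambda>_. measure_pmf (bernoulli_pmf p))"

definition lipschitz_fun :: "nat \<Rightarrow> ((nat \<Rightarrow> int) \<Rightarrow> int) \<Rightarrow> bool" where
  "lipschitz_fun d F \<longleftrightarrow>
     (\<forall>x\<in>lattice_pts d. \<forall>y\<in>lattice_pts d.
        l1_norm d (\<lambda>i. x i - y i) = 1 \<longrightarrow> \<bar>F x - F y\<bar> \<le> 1)"

definition tilts :: "nat \<Rightarrow> (nat \<Rightarrow> int) set" where
  "tilts d = {1..d} \<rightarrow>\<^sub>E {-1, 0, 1}"

text \<open>The site \<open>(x, F x)\<close> of the lattice of dimension \<open>d + 1\<close> is \<open>x(Suc d := F x)\<close>.\<close>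

definition LIP :: "real \<Rightarrow> nat \<Rightarrow> (nat \<Rightarrow> int) \<Rightarrow> ((nat \<Rightarrow> int) \<Rightarrow> bool) set" where
  "LIP \<alpha> d \<eta> =
     {\<omega> \<in> configs (Suc d). \<exists>F. lipschitz_fun d F \<and>
        (\<forall>x\<in>lattice_pts d. \<omega> (x(Suc d := F x)) \<and>
           F x > \<lfloor>\<alpha> * real_of_int (\<Sum>i=1..d. \<eta> i * x i)\<rfloor>)}"

definition is_critical_prob :: "real \<Rightarrow> nat \<Rightarrow> (nat \<Rightarrow> int) \<Rightarrow> real \<Rightarrow> bool" where
  "is_critical_prob \<alpha> d \<eta> pc \<longleftrightarrow>
     0 < pc \<and> pc < 1 \<and>
     (\<forall>p\<in>{0..1}. p < pc \<longrightarrow> measure (site_perc (Suc d) p) (LIP \<alpha> d \<eta>) = 0) \<and>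
     (\<forall>p\<in>{0..1}. pc < p \<longrightarrow> measure (site_perc (Suc d) p) (LIP \<alpha> d \<eta>) = 1)"

definition p_L_tilt :: "real \<Rightarrow> nat \<Rightarrow> (nat \<Rightarrow> int) \<Rightarrow> real" where
  "p_L_tilt \<alpha> d \<eta> = (THE pc. is_critical_prob \<alpha> d \<eta> pc)"

text \<open>
  For \<open>0 \<le> \<alpha> < 1\<close>, \<open>d \<ge> 1\<close> and \<open>k \<le> d\<close> the critical probability exists, is unique, and is the same
  for all tilts of norm \<open>k\<close>; this common value is \<open>p_L \<alpha> d k\<close>.
\<close>

definition p_L :: "real \<Rightarrow> nat \<Rightarrow> nat \<Rightarrow> real" where
  "p_L \<alpha> d k =
     (THE pc. \<forall>\<eta>\<in>tilts d. l1_norm d \<eta> = int k \<longrightarrow> p_L_tilt \<alpha> d \<eta> = pc)"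

definition q_L :: "real \<Rightarrow> nat \<Rightarrow> nat \<Rightarrow> real" where
  "q_L \<alpha> d k = 1 - p_L \<alpha> d k"

definition asymp_ge :: "(nat \<Rightarrow> real) \<Rightarrow> (nat \<Rightarrow> real) \<Rightarrow> bool" (infix "\<greatersim>" 50) where
  "f \<greatersim> g \<longleftrightarrow> 1 \<le> liminf (\<lambda>d. ereal (f d / g d))"

end

theory Submission
  imports Defs
begin

text \<open>
  The only obstruction to an open Lipschitz surface above the tilted hyperplane is that closed sites may
  let paths climb beyond any height. Call a path admissible if it starts in or below the
  hyperplane, moves up only into closed sites, and otherwise moves down by one together with a unit
  step along one of the \<open>d\<close> horizontal axes. A surface exists exactly if above every base point only
  boundedly many heights are reached by admissible paths, and then the lowest surface runs just above the reached
  sites (\<open>lip_above_iff_reached\<close>).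

  Write \<open>q\<close> for the density of closed sites and \<open>k\<close> for the number of nonzero entries of the
  tilt. Cutting loops, one may assume that the closed sites used by a path are distinct, so that a path
  with \<open>u\<close> upward steps is available with probability \<open>q ^ u\<close>. Give an upward step the weight
  \<open>q z\<close> and a diagonal one the weight \<open>1 / z\<close>, corrected by \<open>z\<close> to the power of the amount, positive or
  negative, by which the hyperplane rises as the path is traced back along it. For any \<open>z > 1\<close> this is an exponential Markov
  bound for the requirement that the path gain enough height, and the total weight of a step is at
  most \<open>q z + (2 d + k z powr \<alpha>) / z\<close> (\<open>sum_weight_le\<close>). If this is less than 1, the probability that height
  \<open>h\<close> is reached decays geometrically in \<open>h\<close>, and a surface exists almost surely
  (\<open>LIP_almost_sure\<close>). Hence, for every \<open>z > 1\<close>,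

  \<open>q_L \<alpha> d k \<ge> (1 - (2 d + k z powr \<alpha>) / z) / z\<close>

  which is \<open>q_L_ge\<close>. The three asymptotic claims are instances: \<open>z = 4 d\<close> for a negligible tilt,
  \<open>z = B d\<close> with a large constant \<open>B\<close> for a tilt of order \<open>d powr (1 - \<alpha>)\<close>, and
  \<open>z = ((2 - \<alpha>) c d) powr (1 / (1 - \<alpha>))\<close> for a tilt proportional to \<open>d\<close>.

  The number \<open>q_L\<close> is given by a definite description, and the path bound says something about it only
  once the critical probability is known to exist, to be unique and to depend on the tilt through its
  norm alone (\<open>is_critical_prob_p_L\<close>). This needs a zero-one law, obtained by raising the hyperplane out
  of the reach of any finite set of sites (\<open>lip_above_zero_one\<close>); monotonicity in the
  density, by coupling (\<open>measure_lip_above_mono\<close>); the absence of surfaces at low density of open sites,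
  by counting open paths in a plane (\<open>lip_above_null\<close>); and the symmetries of the lattice
  (\<open>measure_LIP_tilt_cong\<close>).
\<close>

section \<open>Product measures\<close>

lemma measurable_PiM_map_pmf:
  "(\<lambda>\<omega>. \<lambda>i\<in>I. f (\<omega> i)) \<in> measurable (PiM I (\<lambda>_. measure_pmf \<mu>)) (PiM I (\<lambda>_. measure_pmf (map_pmf f \<mu>)))"
proof (rule measurable_restrict)
  fix i assume "i \<in> I"
  then have "(\<lambda>\<omega>. \<omega> i) \<in> measurable (PiM I (\<lambda>_. measure_pmf \<mu>)) (measure_pmf \<mu>)"
    by (rule measurable_component_singleton)
  then show "(\<lambda>\<omega>. f (\<omega> i)) \<in> measurable (PiM I (\<lambda>_. measure_pmf \<mu>)) (measure_pmf (map_pmf f \<mu>))"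
    by (rule measurable_compose) simp
qed

text \<open>
  This is what makes couplings of two percolation measures possible: both are obtained site by site
  from one field of independent pairs.
\<close>

lemma distr_PiM_map_pmf:
  fixes \<mu> :: "'a pmf" and f :: "'a \<Rightarrow> 'b" and I :: "'i set"
  shows "distr (PiM I (\<lambda>_. measure_pmf \<mu>)) (PiM I (\<lambda>_. measure_pmf (map_pmf f \<mu>)))
           (\<lambda>\<omega>. \<lambda>i\<in>I. f (\<omega> i)) = PiM I (\<lambda>_. measure_pmf (map_pmf f \<mu>))"
    (is "distr ?P ?Q ?t = _")
proof (rule measure_eqI_PiM_infinite[symmetric, OF refl])
  interpret Q: prob_space ?Q
    by (intro prob_space_PiM) (simp add: measure_pmf.prob_space_axioms)
  show "finite_measure ?Q"
    by unfold_locales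
  have meas: "?t \<in> measurable ?P ?Q"
    by (rule measurable_PiM_map_pmf)
  fix A and J :: "'i set"
  assume J: "finite J" "J \<subseteq> I"
  have "?Q (prod_emb I (\<lambda>_. measure_pmf (map_pmf f \<mu>)) J (Pi\<^sub>E J A))
      = (\<Prod>j\<in>J. emeasure (measure_pmf (map_pmf f \<mu>)) (A j))"
    using J by (intro emeasure_PiM_emb) (auto simp: measure_pmf.prob_space_axioms)
  also have "\<dots> = (\<Prod>j\<in>J. emeasure (measure_pmf \<mu>) (f -` A j))"
    by simp
  also have "\<dots> = ?P (prod_emb I (\<lambda>_. measure_pmf \<mu>) J (Pi\<^sub>E J (\<lambda>j. f -` A j)))"
    using J by (intro emeasure_PiM_emb[symmetric]) (auto simp: measure_pmf.prob_space_axioms)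
  also have "prod_emb I (\<lambda>_. measure_pmf \<mu>) J (Pi\<^sub>E J (\<lambda>j. f -` A j))
      = ?t -` prod_emb I (\<lambda>_. measure_pmf (map_pmf f \<mu>)) J (Pi\<^sub>E J A) \<inter> space ?P"
    using J by (auto simp: prod_emb_def space_PiM PiE_iff subset_iff)
  also have "?P \<dots> = distr ?P ?Q ?t (prod_emb I (\<lambda>_. measure_pmf (map_pmf f \<mu>)) J (Pi\<^sub>E J A))"
    using J by (intro emeasure_distr[symmetric] meas sets_PiM_I) auto
  finally show "?Q (prod_emb I (\<lambda>_. measure_pmf (map_pmf f \<mu>)) J (Pi\<^sub>E J A))
      = distr ?P ?Q ?t (prod_emb I (\<lambda>_. measure_pmf (map_pmf f \<mu>)) J (Pi\<^sub>E J A))" .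
qed simp

lemma indep_var_PiM_disjoint:
  assumes M: "\<And>i. i \<in> I \<Longrightarrow> prob_space (M i)"
    and AB: "A \<inter> B = {}" "A \<subseteq> I" "B \<subseteq> I" and ne: "I \<noteq> {}"
  shows "prob_space.indep_var (PiM I M) (PiM A M) (\<lambda>\<omega>. restrict \<omega> A) (PiM B M) (\<lambda>\<omega>. restrict \<omega> B)"
proof -
  interpret prob_space "PiM I M"
    by (rule prob_space_PiM) (rule M)
  have "distr (PiM I M) (PiM I M) (\<lambda>\<omega>. \<lambda>i\<in>I. \<omega> i) = distr (PiM I M) (PiM I M) (\<lambda>\<omega>. \<omega>)"
    by (rule distr_cong) (auto simp: space_PiM PiE_iff extensional_restrict)
  moreover have "(\<Pi>\<^sub>M i\<in>I. distr (PiM I M) (M i) (\<lambda>\<omega>. \<omega> i)) = PiM I M"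
    by (rule PiM_cong) (auto intro: distr_PiM_component M)
  ultimately have "indep_vars M (\<lambda>i \<omega>. \<omega> i) I"
    by (subst indep_vars_iff_distr_eq_PiM'[OF ne]) (auto simp: distr_id2)
  from indep_var_restrict[OF this AB] show ?thesis
    by simp
qed

text \<open>
  Let \<open>P\<close> be the product measure. The hypothesis says that \<open>A\<close> can be replaced, up to a null set, by
  an event \<open>B\<close> that ignores the coordinates in any prescribed finite set \<open>J\<close>. Then \<open>A\<close> is independent
  of every cylinder event, so \<open>P\<close> conditioned on \<open>A\<close> agrees with \<open>P\<close> on cylinders and therefore equals
  \<open>P\<close>. As the conditioned measure gives \<open>A\<close> the mass 1, so does \<open>P\<close>, unless \<open>A\<close> is a null set and one
  cannot condition on it.
\<close>

lemma zero_one_law_PiM: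
  assumes M: "\<And>i. i \<in> I \<Longrightarrow> prob_space (M i)" and ne: "I \<noteq> {}"
    and A: "A \<in> sets (PiM I M)"
    and loc: "\<And>J. finite J \<Longrightarrow> J \<subseteq> I \<Longrightarrow> \<exists>B\<in>sets (PiM I M). B \<subseteq> A \<and>
        measure (PiM I M) B = measure (PiM I M) A \<and>
        (\<forall>\<omega>\<in>space (PiM I M). \<forall>\<omega>'\<in>space (PiM I M). (\<forall>i\<in>I-J. \<omega> i = \<omega>' i) \<longrightarrow> \<omega> \<in> B \<longrightarrow> \<omega>' \<in> B)"
  shows "measure (PiM I M) A = 0 \<or> measure (PiM I M) A = 1"
proof (rule disjCI)
  interpret prob_space "PiM I M"
    by (rule prob_space_PiM) (rule M)
  let ?P = "PiM I M"
  assume "prob A \<noteq> 1"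
  show "prob A = 0"
  proof (rule ccontr)
    assume pos: "prob A \<noteq> 0"
    have cyl: "prob (A \<inter> prod_emb I M J (Pi\<^sub>E J F)) = prob A * prob (prod_emb I M J (Pi\<^sub>E J F))"
      if J: "finite J" "J \<subseteq> I" and F: "\<And>j. j \<in> J \<Longrightarrow> F j \<in> sets (M j)" for J F
    proof -
      let ?E = "prod_emb I M J (Pi\<^sub>E J F)"
      have E: "?E \<in> sets ?P"
        using J F by (intro sets_PiM_I) auto
      obtain B where B: "B \<in> sets ?P" "B \<subseteq> A" "prob B = prob A"
        and BJ: "\<And>\<omega> \<omega>'. \<omega> \<in> space ?P \<Longrightarrow> \<omega>' \<in> space ?P \<Longrightarrow> (\<forall>i\<in>I-J. \<omega> i = \<omega>' i) \<Longrightarrow> \<omega> \<in> B \<Longrightarrow> \<omega>' \<in> B"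
        using loc[OF J] by blast
      obtain b where b: "b \<in> space ?P"
        using not_empty by blast
      \<comment> \<open>Overwriting the coordinates in \<open>J\<close> by fixed values exhibits \<open>B\<close> as an event of the other
          coordinates.\<close>
      define ext where "ext = (\<lambda>\<omega>. \<lambda>i\<in>I. if i \<in> J then b i else \<omega> i)"
      have ext: "ext \<in> measurable (PiM (I - J) M) ?P"
        unfolding ext_def
      proof (rule measurable_restrict)
        fix i assume i: "i \<in> I"
        show "(\<lambda>\<omega>. if i \<in> J then b i else \<omega> i) \<in> measurable (PiM (I - J) M) (M i)"
          using b i by (cases "i \<in> J") (auto simp: space_PiM PiE_iff intro!: measurable_component_singleton)
      qed
      let ?X = "\<lambda>\<omega>. restrict \<omega> J" and ?Y = "\<lambda>\<omega>. restrict \<omega> (I - J)"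
      let ?C = "ext -` B \<inter> space (PiM (I - J) M)"
      have ind: "indep_var (PiM J M) ?X (PiM (I - J) M) ?Y"
        using indep_var_PiM_disjoint[of I M J "I - J"] M J ne by auto
      have C: "?C \<in> sets (PiM (I - J) M)"
        using ext B(1) by (rule measurable_sets)
      have F': "Pi\<^sub>E J F \<in> sets (PiM J M)"
        using J F by (intro sets_PiM_I_finite) auto
      have eqE: "?E = ?X -` (Pi\<^sub>E J F) \<inter> space ?P"
        by (auto simp: prod_emb_def space_PiM)
      have ext_in: "ext (?Y \<omega>) \<in> space ?P" if "\<omega> \<in> space ?P" for \<omega>
        using that b by (auto simp: ext_def space_PiM PiE_iff)
      have eqB: "B = ?Y -` ?C \<inter> space ?P"
      proof (intro set_eqI iffI)
        fix \<omega> assume w: "\<omega> \<in> B"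
        then have ws: "\<omega> \<in> space ?P"
          using B(1) sets.sets_into_space by auto
        have "ext (?Y \<omega>) \<in> B"
          by (rule BJ[OF ws ext_in[OF ws] _ w]) (auto simp: ext_def)
        then show "\<omega> \<in> ?Y -` ?C \<inter> space ?P"
          using ws by (auto simp: space_PiM PiE_iff)
      next
        fix \<omega> assume w: "\<omega> \<in> ?Y -` ?C \<inter> space ?P"
        show "\<omega> \<in> B"
          by (rule BJ[of "ext (?Y \<omega>)"]) (use w ext_in in \<open>auto simp: ext_def\<close>)
      qed
      have "prob (?E \<inter> B) = prob ((\<lambda>\<omega>. (?X \<omega>, ?Y \<omega>)) -` (Pi\<^sub>E J F \<times> ?C) \<inter> space ?P)"
        by (rule arg_cong[where f=prob], subst eqE, subst eqB) auto
      also have "\<dots> = prob (?X -` (Pi\<^sub>E J F) \<inter> space ?P) * prob (?Y -` ?C \<inter> space ?P)"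
        by (rule indep_varD[OF ind F' C])
      also have "\<dots> = prob ?E * prob B"
        using eqE eqB by simp
      finally have 1: "prob (?E \<inter> B) = prob ?E * prob A"
        using B by simp
      have "prob (A - B) = 0"
        using finite_measure_Diff[OF A B(1,2)] B(3) by simp
      moreover have "prob (A \<inter> ?E) \<le> prob ((?E \<inter> B) \<union> (A - B))"
        using A B(1) E by (intro finite_measure_mono) auto
      moreover have "prob ((?E \<inter> B) \<union> (A - B)) \<le> prob (?E \<inter> B) + prob (A - B)"
        using A B(1) E by (intro measure_Un_le) auto
      moreover have "prob (?E \<inter> B) \<le> prob (A \<inter> ?E)"
        using A B E by (intro finite_measure_mono) auto
      ultimately show ?thesis
        using 1 by (simp add: mult.commute)
    qed
    have eposA: "emeasure ?P A \<noteq> 0"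
      using pos by (simp add: emeasure_eq_measure)
    \<comment> \<open>The measure conditioned on the event agrees with the product measure on cylinders.\<close>
    have "uniform_measure ?P A = ?P"
    proof (rule measure_eqI_PiM_infinite[symmetric, OF refl])
      show "finite_measure ?P" by unfold_locales
      fix F J assume J: "finite J" "J \<subseteq> I" and F: "\<And>i. i \<in> J \<Longrightarrow> F i \<in> sets (M i)"
      let ?E = "prod_emb I M J (Pi\<^sub>E J F)"
      have E: "?E \<in> sets ?P"
        using J F by (intro sets_PiM_I) auto
      have "measure (uniform_measure ?P A) ?E = prob ?E"
        using cyl[OF J F] pos eposA E A by (simp add: measure_uniform_measure emeasure_eq_measure)
      moreover have "emeasure (uniform_measure ?P A) ?E = emeasure ?P (A \<inter> ?E) / emeasure ?P A"
        using A E by simp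
      ultimately show "emeasure ?P ?E = emeasure (uniform_measure ?P A) ?E"
        using eposA pos by (simp add: cyl[OF J F] emeasure_eq_measure divide_ennreal zero_less_measure_iff)
    qed simp
    then have "measure ?P A = measure (uniform_measure ?P A) A"
      by simp
    also have "\<dots> = 1"
      using A eposA pos by (simp add: measure_uniform_measure emeasure_eq_measure)
    finally show False
      using \<open>prob A \<noteq> 1\<close> by simp
  qed
qed

section \<open>Open Lipschitz surfaces and admissible paths\<close>

text \<open>
  The event \<open>LIP\<close> with an arbitrary height function \<open>L\<close> in place of the tilted hyperplane. The extra
  generality is what allows the hyperplane to be raised by a constant, the device behind the
  zero-one law.
\<close>

definition lip_above :: "nat \<Rightarrow> ((nat \<Rightarrow> int) \<Rightarrow> int) \<Rightarrow> ((nat \<Rightarrow> int) \<Rightarrow> bool) set" where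
  "lip_above d L = {\<omega> \<in> configs (Suc d). \<exists>F. lipschitz_fun d F \<and>
     (\<forall>x\<in>lattice_pts d. \<omega> (x(Suc d := F x)) \<and> F x > L x)}"

lemma LIP_eq_lip_above: "LIP \<alpha> d \<eta> = lip_above d (\<lambda>x. \<lfloor>\<alpha> * real_of_int (\<Sum>i=1..d. \<eta> i * x i)\<rfloor>)"
  by (simp add: LIP_def lip_above_def)

definition site :: "nat \<Rightarrow> (nat \<Rightarrow> int) \<times> int \<Rightarrow> nat \<Rightarrow> int" where
  "site d v = (fst v)(Suc d := snd v)"

lemma site_Pair: "site d (x, h) = x(Suc d := h)"
  by (simp add: site_def)

lemma site_in_lattice: "fst v \<in> lattice_pts d \<Longrightarrow> site d v \<in> lattice_pts (Suc d)"
  by (auto simp: site_def lattice_pts_def PiE_iff extensional_def)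

lemma site_eq_iff:
  assumes "fst u \<in> lattice_pts d" "fst v \<in> lattice_pts d"
  shows "site d u = site d v \<longleftrightarrow> u = v"
proof
  assume eq: "site d u = site d v"
  have "fst u i = fst v i" for i
  proof (cases "i = Suc d")
    case True
    then show ?thesis
      using assms by (auto simp: lattice_pts_def PiE_iff extensional_def)
  next
    case False
    then show ?thesis
      using fun_cong[OF eq, of i] by (simp add: site_def)
  qed
  moreover have "snd u = snd v"
    using fun_cong[OF eq, of "Suc d"] by (simp add: site_def)
  ultimately show "u = v"
    by (auto simp: prod_eq_iff)
qed simp

text \<open>
  A site of the lattice of dimension \<open>d + 1\<close> is a pair of a base point and a height. Steps trace an
  admissible path of the region under the surface backwards, from a site down to the hyperplane:
  \<open>None\<close> goes straight down and is available only at closed sites, whereas \<open>Some (j, s)\<close> goes up by one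
  while moving by \<open>s\<close> along the axis \<open>j\<close>, without any condition. In the forward direction an
  admissible path climbs into closed sites and descends diagonally for free.
\<close>

type_synonym step = "(nat \<times> int) option"

fun move :: "step \<Rightarrow> (nat \<Rightarrow> int) \<times> int \<Rightarrow> (nat \<Rightarrow> int) \<times> int" where
  "move None (x, h) = (x, h - 1)"
| "move (Some (j, s)) (x, h) = (x(j := x j + s), h + 1)"

text \<open>
  The sites that have to be closed for the path to be admissible.
\<close>

fun drops :: "(nat \<Rightarrow> int) \<times> int \<Rightarrow> step list \<Rightarrow> ((nat \<Rightarrow> int) \<times> int) list" where
  "drops v [] = []"
| "drops v (e # w) = (if e = None then [v] else []) @ drops (move e v) w"

definition steps :: "nat \<Rightarrow> step set" where
  "steps d = insert None (Some ` ({1..d} \<times> {-1, 1}))"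

definition descends :: "nat \<Rightarrow> ((nat \<Rightarrow> int) \<Rightarrow> int) \<Rightarrow> (nat \<Rightarrow> int) \<times> int \<Rightarrow> step list \<Rightarrow> bool" where
  "descends d L v w \<longleftrightarrow> w \<in> lists (steps d) \<and> snd (fold move w v) \<le> L (fst (fold move w v))"

definition reached :: "nat \<Rightarrow> ((nat \<Rightarrow> int) \<Rightarrow> int) \<Rightarrow> ((nat \<Rightarrow> int) \<Rightarrow> bool) \<Rightarrow> (nat \<Rightarrow> int) \<times> int \<Rightarrow> bool" where
  "reached d L \<omega> v \<longleftrightarrow> (\<exists>w. descends d L v w \<and> (\<forall>u\<in>set (drops v w). \<not> \<omega> (site d u)))"

lemma move_in_lattice: "e \<in> steps d \<Longrightarrow> fst v \<in> lattice_pts d \<Longrightarrow> fst (move e v) \<in> lattice_pts d"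
  by (cases v) (auto simp: steps_def lattice_pts_def PiE_iff extensional_def)

lemma drops_in_lattice:
  "w \<in> lists (steps d) \<Longrightarrow> fst v \<in> lattice_pts d \<Longrightarrow> u \<in> set (drops v w) \<Longrightarrow> fst u \<in> lattice_pts d"
proof (induction w arbitrary: v)
  case (Cons e w)
  have "fst (move e v) \<in> lattice_pts d"
    using Cons.prems by (intro move_in_lattice) auto
  then show ?case
    using Cons.IH[of "move e v"] Cons.prems by (auto split: if_splits)
qed simp

lemma length_drops: "length (drops v w) = count_list w None"
  by (induction w arbitrary: v) auto

text \<open>
  The path can be started again at any of its drops, and then its drops are a final segment of the
  original ones.
\<close>

lemma suffix_from_drop:
  assumes "u \<in> set (drops v w)"
  shows "\<exists>w1 w2. w = w1 @ w2 \<and> fold move w1 v = u \<and> (\<exists>zs. drops v w = zs @ drops u w2)"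
  using assms
proof (induction w arbitrary: v)
  case (Cons e w)
  show ?case
  proof (cases "u = v")
    case True
    then show ?thesis
      by (intro exI[of _ "[]"] exI[of _ "e # w"]) auto
  next
    case False
    then have "u \<in> set (drops (move e v) w)"
      using Cons.prems by (auto split: if_splits)
    from Cons.IH[OF this] obtain w1 w2 zs
      where "w = w1 @ w2" "fold move w1 (move e v) = u" "drops (move e v) w = zs @ drops u w2"
      by blast
    then show ?thesis
      by (intro exI[of _ "e # w1"] exI[of _ w2]) auto
  qed
qed simp

text \<open>
  A path that drops twice at the same site contains a loop between the two drops, which can be cut
  out. Only distinct drops make the probability that all of them are closed a power with the number
  of drops as exponent.
\<close>

lemma distinct_drops:
  assumes "w \<in> lists (steps d)"
  shows "\<exists>w'\<in>lists (steps d). fold move w' v = fold move w v \<and>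
    set (drops v w') \<subseteq> set (drops v w) \<and> distinct (drops v w')"
  using assms
proof (induction w arbitrary: v rule: list.induct)
  case (Cons e w)
  then obtain w' where w': "w' \<in> lists (steps d)" "fold move w' (move e v) = fold move w (move e v)"
    "set (drops (move e v) w') \<subseteq> set (drops (move e v) w)" "distinct (drops (move e v) w')"
    by (metis lists.Cons Cons_in_lists_iff)
  show ?case
  proof (cases "e = None \<and> v \<in> set (drops (move e v) w')")
    case False
    then show ?thesis
      using w' Cons.prems by (intro bexI[of _ "e # w'"]) auto
  next
    case True
    then obtain w1 w2 zs where "w' = w1 @ w2" "fold move w1 (move e v) = v"
      "drops (move e v) w' = zs @ drops v w2"
      using suffix_from_drop by metis
    then show ?thesis
      using w' by (intro bexI[of _ w2]) auto
  qed
qed (auto intro!: bexI[of _ "[]"])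

lemma reached_distinct:
  assumes "reached d L \<omega> v"
  shows "\<exists>w. descends d L v w \<and> distinct (drops v w) \<and> (\<forall>u\<in>set (drops v w). \<not> \<omega> (site d u))"
proof -
  obtain w where w: "descends d L v w" "\<forall>u\<in>set (drops v w). \<not> \<omega> (site d u)"
    using assms by (auto simp: reached_def)
  then obtain w' where "w' \<in> lists (steps d)" "fold move w' v = fold move w v"
    "set (drops v w') \<subseteq> set (drops v w)" "distinct (drops v w')"
    using distinct_drops[of w d v] by (auto simp: descends_def)
  then show ?thesis
    using w by (intro exI[of _ w']) (auto simp: descends_def)
qed

lemma l1_neighbour:
  assumes "x \<in> lattice_pts d" "y \<in> lattice_pts d" "l1_norm d (\<lambda>i. x i - y i) = 1"
  obtains j s where "j \<in> {1..d}" "s \<in> {-1, 1}" "y = x(j := x j + s)"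
proof -
  have "int (\<Sum>i=1..d. nat \<bar>x i - y i\<bar>) = 1"
    using assms(3) by (simp add: l1_norm_def)
  then have "(\<Sum>i=1..d. nat \<bar>x i - y i\<bar>) = 1"
    by linarith
  then obtain j where j: "j \<in> {1..d}" "nat \<bar>x j - y j\<bar> = 1"
    "\<And>i. i \<in> {1..d} \<Longrightarrow> i \<noteq> j \<Longrightarrow> nat \<bar>x i - y i\<bar> = 0"
    by (subst (asm) sum_eq_1_iff) auto
  have "y = x(j := x j + (y j - x j))"
  proof
    fix i
    show "y i = (x(j := x j + (y j - x j))) i"
      using j(3)[of i] assms(1,2) by (cases "i \<in> {1..d}") (auto simp: lattice_pts_def PiE_iff extensional_def)
  qed
  moreover have "y j - x j \<in> {-1, 1}"
    using j(2) by auto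
  ultimately show ?thesis
    using that j(1) by blast
qed

lemma l1_neighbourI:
  assumes "j \<in> {1..d}" "s \<in> {-1, 1}"
  shows "l1_norm d (\<lambda>i. x i - (x(j := x j + s)) i) = 1"
proof -
  have "l1_norm d (\<lambda>i. x i - (x(j := x j + s)) i) = (\<Sum>i=1..d. if i = j then 1 else 0)"
    unfolding l1_norm_def using assms by (intro sum.cong) auto
  then show ?thesis
    using assms by simp
qed

lemma reached_Cons:
  assumes "e \<in> steps d" "reached d L \<omega> (move e v)" "e = None \<Longrightarrow> \<not> \<omega> (site d v)"
  shows "reached d L \<omega> v"
proof -
  obtain w where "descends d L (move e v) w" "\<forall>u\<in>set (drops (move e v) w). \<not> \<omega> (site d u)"
    using assms(2) by (auto simp: reached_def)
  then show ?thesis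
    using assms unfolding reached_def by (intro exI[of _ "e # w"]) (auto simp: descends_def)
qed

text \<open>
  An open Lipschitz surface is a barrier for admissible paths. Followed backwards from a site, the
  path ends below the surface; a free step changes the height of the surface by at most one while it
  rises by one, and a drop cannot take place on the surface because the surface is open.
\<close>

lemma reached_below_surface:
  assumes F: "lipschitz_fun d F" "\<And>x. x \<in> lattice_pts d \<Longrightarrow> \<omega> (x(Suc d := F x)) \<and> F x > L x"
    and "x \<in> lattice_pts d" "reached d L \<omega> (x, h)"
  shows "h < F x"
proof -
  obtain w where "descends d L (x, h) w" "\<forall>u\<in>set (drops (x, h) w). \<not> \<omega> (site d u)"
    using assms(4) by (auto simp: reached_def)
  then show ?thesis
    using assms(3)
  proof (induction w arbitrary: x h)
    case Nil
    then show ?case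
      using F(2)[of x] by (auto simp: descends_def)
  next
    case (Cons e w)
    have e: "e \<in> steps d" and d': "descends d L (move e (x, h)) w"
      using Cons.prems(1) by (auto simp: descends_def)
    show ?case
    proof (cases e)
      case None
      have "h - 1 < F x"
        using Cons.IH[of x "h - 1"] d' Cons.prems None by simp
      moreover have "h \<noteq> F x"
        using Cons.prems None F(2)[of x] by (auto simp: site_Pair)
      ultimately show ?thesis
        by linarith
    next
      case (Some a)
      obtain j s where a: "a = (j, s)" by (cases a)
      define y where "y = x(j := x j + s)"
      have js: "j \<in> {1..d}" "s \<in> {-1, 1}"
        using e Some a by (auto simp: steps_def)
      have y: "y \<in> lattice_pts d"
        using move_in_lattice[OF e, of "(x, h)"] Cons.prems Some a by (simp add: y_def)
      have m: "move e (x, h) = (y, h + 1)"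
        by (simp add: Some a y_def)
      have "h + 1 < F y"
        using Cons.IH[of y "h + 1"] d' Cons.prems(2) y unfolding m by (simp add: Some m[unfolded Some])
      moreover have "\<bar>F x - F y\<bar> \<le> 1"
        using F(1) y Cons.prems(3) l1_neighbourI[OF js, of x] unfolding lipschitz_fun_def y_def by blast
      ultimately show ?thesis
        by linarith
    qed
  qed
qed

text \<open>
  If the reached sites above every base point are bounded, then the sites just above the highest
  reached ones form an open Lipschitz surface: a closed site there would be reached itself by one more
  vertical step, and a jump by more than one is ruled out by the diagonal steps. Conversely every
  surface bounds the reached heights. Heights are natural numbers here because only large ones matter,
  which suits the Borel--Cantelli lemma below.
\<close>

lemma lip_above_iff_reached:
  assumes \<omega>: "\<omega> \<in> configs (Suc d)"
  shows "\<omega> \<in> lip_above d L \<longleftrightarrow> (\<forall>x\<in>lattice_pts d. \<exists>n::nat. \<forall>m\<ge>n. \<not> reached d L \<omega> (x, int m))"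
proof
  assume "\<omega> \<in> lip_above d L"
  then obtain F where F: "lipschitz_fun d F"
    "\<And>x. x \<in> lattice_pts d \<Longrightarrow> \<omega> (x(Suc d := F x)) \<and> F x > L x"
    by (auto simp: lip_above_def)
  show "\<forall>x\<in>lattice_pts d. \<exists>n::nat. \<forall>m\<ge>n. \<not> reached d L \<omega> (x, int m)"
  proof (intro ballI exI allI impI notI)
    fix x m assume x: "x \<in> lattice_pts d" and "nat (F x) \<le> m" "reached d L \<omega> (x, int m)"
    then show False
      using reached_below_surface[where F=F, OF F x] by fastforce
  qed
next
  assume bdd: "\<forall>x\<in>lattice_pts d. \<exists>n::nat. \<forall>m\<ge>n. \<not> reached d L \<omega> (x, int m)"
  have base: "reached d L \<omega> (x, L x)" for x
    unfolding reached_def by (intro exI[of _ "[]"]) (simp add: descends_def)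
  have "\<exists>f. reached d L \<omega> (x, f - 1) \<and> L x < f \<and> (\<forall>h\<ge>f. \<not> reached d L \<omega> (x, h))"
    if x: "x \<in> lattice_pts d" for x
  proof -
    obtain n :: nat where n: "\<And>m. m \<ge> n \<Longrightarrow> \<not> reached d L \<omega> (x, int m)"
      using bdd x by blast
    have n': "h < int n" if "reached d L \<omega> (x, h)" for h
    proof (rule ccontr)
      assume "\<not> h < int n"
      then have "n \<le> nat h" "int (nat h) = h" by auto
      then show False using n[of "nat h"] that by simp
    qed
    \<comment> \<open>Heights below \<open>L x\<close> are discarded so that a finite set remains.\<close>
    define S where "S = {h. L x \<le> h \<and> reached d L \<omega> (x, h)}"
    have S_iff: "h \<in> S \<longleftrightarrow> L x \<le> h \<and> reached d L \<omega> (x, h)" for h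
      by (simp add: S_def)
    have fin: "finite S"
      by (rule finite_subset[of _ "{L x..int n}"]) (use n' in \<open>force simp: S_def\<close>)+
    moreover have "L x \<in> S"
      by (simp only: S_iff base order_refl simp_thms)
    ultimately have mem: "Max S \<in> S"
      by (intro Max_in) auto
    then have M: "reached d L \<omega> (x, Max S)" "L x \<le> Max S"
      by (simp_all only: S_iff)
    have max: "h \<le> Max S" if "reached d L \<omega> (x, h)" "L x \<le> h" for h
      by (rule Max_ge[OF fin]) (simp only: S_iff that)
    have "\<not> reached d L \<omega> (x, h)" if "Max S + 1 \<le> h" for h
      using max[of h] M(2) that by linarith
    moreover have "reached d L \<omega> (x, Max S + 1 - 1)" "L x < Max S + 1"
      using M by simp_all
    ultimately show ?thesis
      by blast
  qed
  then have "\<forall>x\<in>lattice_pts d. \<exists>f. reached d L \<omega> (x, f - 1) \<and> L x < f \<and> (\<forall>h\<ge>f. \<not> reached d L \<omega> (x, h))"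
    by (rule ballI)
  from bchoice[OF this] obtain F where "\<forall>x\<in>lattice_pts d.
      reached d L \<omega> (x, F x - 1) \<and> L x < F x \<and> (\<forall>h\<ge>F x. \<not> reached d L \<omega> (x, h))" ..
  then have F: "reached d L \<omega> (x, F x - 1) \<and> L x < F x \<and> (\<forall>h\<ge>F x. \<not> reached d L \<omega> (x, h))"
    if "x \<in> lattice_pts d" for x
    using that by (rule bspec)
  have "\<omega> (x(Suc d := F x))" if x: "x \<in> lattice_pts d" for x
  proof (rule ccontr)
    assume "\<not> \<omega> (x(Suc d := F x))"
    then have "reached d L \<omega> (x, F x)"
      using F[OF x] by - (rule reached_Cons[of None], auto simp: steps_def site_Pair)
    then show False
      using F[OF x] by blast
  qed
  moreover have le: "F y - F x \<le> 1"
    if x: "x \<in> lattice_pts d" and y: "y \<in> lattice_pts d" and n: "l1_norm d (\<lambda>i. x i - y i) = 1" for x y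
  proof -
    obtain j s where js: "j \<in> {1..d}" "s \<in> {-1, 1}" "y = x(j := x j + s)"
      using l1_neighbour[OF x y n] .
    have "reached d L \<omega> (x, F y - 2)"
      using F[OF y] js by - (rule reached_Cons[of "Some (j, s)"], auto simp: steps_def)
    then show ?thesis
      using F[OF x] by (smt (verit))
  qed
  moreover have "lipschitz_fun d F"
    unfolding lipschitz_fun_def
  proof (intro ballI impI)
    fix x y assume *: "x \<in> lattice_pts d" "y \<in> lattice_pts d" "l1_norm d (\<lambda>i. x i - y i) = 1"
    then have "l1_norm d (\<lambda>i. y i - x i) = 1"
      by (simp add: l1_norm_def abs_minus_commute)
    then show "\<bar>F x - F y\<bar> \<le> 1"
      using le[of x y] le[of y x] * by linarith
  qed
  ultimately show "\<omega> \<in> lip_above d L"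
    using \<omega> F by (auto simp: lip_above_def)
qed

section \<open>Measurability\<close>

lemma space_site_perc: "space (site_perc n p) = configs n"
  by (simp add: site_perc_def space_PiM configs_def)

lemma prob_space_site_perc: "prob_space (site_perc n p)"
  unfolding site_perc_def by (intro prob_space_PiM) (simp add: measure_pmf.prob_space_axioms)

lemma countable_lattice_pts: "countable (lattice_pts n)"
  unfolding lattice_pts_def by (intro countable_PiE) auto

lemma lattice_pts_nonempty: "lattice_pts n \<noteq> {}"
  by (simp add: lattice_pts_def PiE_eq_empty_iff)

lemma site_perc_all_equal:
  assumes S: "finite S" "S \<subseteq> lattice_pts n"
  shows "{\<omega> \<in> configs n. \<forall>y\<in>S. \<omega> y = b} \<in> sets (site_perc n p)"
    and "measure (site_perc n p) {\<omega> \<in> configs n. \<forall>y\<in>S. \<omega> y = b} = pmf (bernoulli_pmf p) b ^ card S"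
proof -
  interpret product_prob_space "\<lambda>_. measure_pmf (bernoulli_pmf p)" "lattice_pts n"
    by unfold_locales
  have restrict_eq: "restrict \<omega> S = (\<lambda>y\<in>S. b) \<longleftrightarrow> (\<forall>y\<in>S. \<omega> y = b)" for \<omega>
  proof
    assume eq: "restrict \<omega> S = (\<lambda>y\<in>S. b)"
    show "\<forall>y\<in>S. \<omega> y = b"
    proof
      fix y assume "y \<in> S"
      then show "\<omega> y = b"
        using fun_cong[OF eq, of y] by simp
    qed
  qed (auto intro!: restrict_ext)
  have eq: "{\<omega> \<in> configs n. \<forall>y\<in>S. \<omega> y = b} = emb (lattice_pts n) S (Pi\<^sub>E S (\<lambda>_. {b}))"
    by (rule set_eqI) (simp add: prod_emb_def configs_def PiE_iff restrict_eq conj_commute)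
  show "{\<omega> \<in> configs n. \<forall>y\<in>S. \<omega> y = b} \<in> sets (site_perc n p)"
    unfolding eq site_perc_def using S by (intro sets_PiM_I) auto
  have "measure (site_perc n p) {\<omega> \<in> configs n. \<forall>y\<in>S. \<omega> y = b} = (\<Prod>i\<in>S. measure (measure_pmf (bernoulli_pmf p)) {b})"
    unfolding eq site_perc_def using S by (intro measure_PiM_emb) auto
  then show "measure (site_perc n p) {\<omega> \<in> configs n. \<forall>y\<in>S. \<omega> y = b} = pmf (bernoulli_pmf p) b ^ card S"
    by (simp add: measure_pmf_single)
qed

lemma drops_closed_event:
  assumes w: "w \<in> lists (steps d)" and v: "fst v \<in> lattice_pts d"
  shows "{\<omega> \<in> configs (Suc d). \<forall>u\<in>set (drops v w). \<not> \<omega> (site d u)} \<in> sets (site_perc (Suc d) p)"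
    and "distinct (drops v w) \<Longrightarrow> p \<in> {0..1} \<Longrightarrow>
      measure (site_perc (Suc d) p) {\<omega> \<in> configs (Suc d). \<forall>u\<in>set (drops v w). \<not> \<omega> (site d u)}
        = (1 - p) ^ count_list w None"
proof -
  let ?S = "site d ` set (drops v w)"
  have eq: "{\<omega> \<in> configs (Suc d). \<forall>u\<in>set (drops v w). \<not> \<omega> (site d u)} = {\<omega> \<in> configs (Suc d). \<forall>y\<in>?S. \<omega> y = False}"
    by auto
  have S: "finite ?S" "?S \<subseteq> lattice_pts (Suc d)"
    using drops_in_lattice[OF w v] by (auto intro!: site_in_lattice)
  show "{\<omega> \<in> configs (Suc d). \<forall>u\<in>set (drops v w). \<not> \<omega> (site d u)} \<in> sets (site_perc (Suc d) p)"
    unfolding eq by (rule site_perc_all_equal[OF S])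
  assume "distinct (drops v w)" "p \<in> {0..1}"
  moreover have "inj_on (site d) (set (drops v w))"
    using drops_in_lattice[OF w v] by (auto simp: inj_on_def site_eq_iff)
  ultimately show "measure (site_perc (Suc d) p) {\<omega> \<in> configs (Suc d). \<forall>u\<in>set (drops v w). \<not> \<omega> (site d u)}
        = (1 - p) ^ count_list w None"
    unfolding eq site_perc_all_equal(2)[OF S]
    by (simp add: card_image distinct_card length_drops)
qed

lemma reached_event:
  assumes v: "fst v \<in> lattice_pts d"
  shows "{\<omega> \<in> configs (Suc d). reached d L \<omega> v} \<in> sets (site_perc (Suc d) p)"
proof -
  have "{\<omega> \<in> configs (Suc d). reached d L \<omega> v} =
      (\<Union>w\<in>{w. descends d L v w}. {\<omega> \<in> configs (Suc d). \<forall>u\<in>set (drops v w). \<not> \<omega> (site d u)})"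
    by (auto simp: reached_def)
  also have "\<dots> \<in> sets (site_perc (Suc d) p)"
    by (intro sets.countable_UN') (auto simp: descends_def intro!: drops_closed_event v)
  finally show ?thesis .
qed

text \<open>
  The existential quantifier over surfaces is not countable, but the characterisation by paths has
  only countable quantifiers.
\<close>

lemma sets_lip_above: "lip_above d L \<in> sets (site_perc (Suc d) p)"
proof -
  let ?M = "site_perc (Suc d) p"
  have "lip_above d L = {\<omega> \<in> space ?M. \<forall>x\<in>lattice_pts d. \<exists>n::nat. \<forall>m\<in>{n..}. \<not> reached d L \<omega> (x, int m)}"
  proof (rule set_eqI)
    fix \<omega>
    show "\<omega> \<in> lip_above d L \<longleftrightarrow> \<omega> \<in> {\<omega> \<in> space ?M. \<forall>x\<in>lattice_pts d. \<exists>n::nat. \<forall>m\<in>{n..}. \<not> reached d L \<omega> (x, int m)}"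
    proof (cases "\<omega> \<in> configs (Suc d)")
      case True
      then show ?thesis
        by (simp add: lip_above_iff_reached space_site_perc Ball_def)
    qed (simp add: space_site_perc lip_above_def)
  qed
  also have "\<dots> \<in> sets ?M"
  proof (intro sets.sets_Collect_countable_All' sets.sets_Collect_countable_Ex sets.sets_Collect_neg)
    fix x m assume "x \<in> lattice_pts d"
    then show "{\<omega> \<in> space ?M. reached d L \<omega> (x, int m)} \<in> sets ?M"
      unfolding space_site_perc by (intro reached_event) simp
  qed (auto simp: countable_lattice_pts)
  finally show ?thesis .
qed

section \<open>Counting admissible paths\<close>

lemma sum_lists_prod:
  fixes f :: "'a \<Rightarrow> real"
  assumes "finite A"
  shows "(\<Sum>xs | set xs \<subseteq> A \<and> length xs = n. \<Prod>x\<leftarrow>xs. f x) = (\<Sum>x\<in>A. f x) ^ n"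
proof (induction n)
  case 0
  have "{xs. set xs \<subseteq> A \<and> length xs = 0} = {[]}"
    by auto
  then show ?case by simp
next
  case (Suc n)
  let ?X = "\<lambda>n. {xs. set xs \<subseteq> A \<and> length xs = n}"
  have "?X (Suc n) = (\<lambda>(x, xs). x # xs) ` (A \<times> ?X n)"
    by (auto simp: length_Suc_conv image_iff)
  moreover have "inj_on (\<lambda>x. fst x # snd x) (A \<times> ?X n)"
    by (auto simp: inj_on_def)
  ultimately have "(\<Sum>xs\<in>?X (Suc n). \<Prod>x\<leftarrow>xs. f x) = (\<Sum>(x, xs)\<in>A \<times> ?X n. f x * (\<Prod>x\<leftarrow>xs. f x))"
    by (simp add: sum.reindex case_prod_beta)
  also have "\<dots> = (\<Sum>x\<in>A. f x) * (\<Sum>xs\<in>?X n. \<Prod>x\<leftarrow>xs. f x)"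
    by (simp add: sum_product sum.cartesian_product)
  finally show ?case
    using Suc by simp
qed

text \<open>
  The nonnegativity of \<open>excess\<close> at the end of a path says that the path has come down to the tilted
  hyperplane. It is additive along the steps, and so its exponential can be used as a Chernoff weight.
\<close>

definition excess :: "real \<Rightarrow> nat \<Rightarrow> (nat \<Rightarrow> int) \<Rightarrow> (nat \<Rightarrow> int) \<times> int \<Rightarrow> real" where
  "excess \<alpha> d \<eta> v = \<alpha> * real_of_int (\<Sum>i=1..d. \<eta> i * fst v i) - real_of_int (snd v)"

fun gain :: "real \<Rightarrow> (nat \<Rightarrow> int) \<Rightarrow> step \<Rightarrow> real" where
  "gain \<alpha> \<eta> None = 1"
| "gain \<alpha> \<eta> (Some (j, s)) = \<alpha> * real_of_int (\<eta> j * s) - 1"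

lemma excess_move:
  assumes "e \<in> steps d"
  shows "excess \<alpha> d \<eta> (move e v) = excess \<alpha> d \<eta> v + gain \<alpha> \<eta> e"
proof (cases e)
  case None
  then show ?thesis
    by (cases v) (simp add: excess_def)
next
  case (Some a)
  obtain j s where a: "a = (j, s)" by (cases a)
  obtain x h where v: "v = (x, h)" by (cases v)
  have j: "j \<in> {1..d}"
    using assms Some a by (auto simp: steps_def)
  have "(\<Sum>i=1..d. \<eta> i * (x(j := x j + s)) i) = (\<Sum>i=1..d. \<eta> i * x i + (if i = j then \<eta> j * s else 0))"
    by (intro sum.cong) (auto simp: algebra_simps)
  also have "\<dots> = (\<Sum>i=1..d. \<eta> i * x i) + \<eta> j * s"
    using j by (simp add: sum.distrib)
  finally have "(\<Sum>i=1..d. \<eta> i * (x(j := x j + s)) i) = (\<Sum>i=1..d. \<eta> i * x i) + \<eta> j * s" .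
  then show ?thesis
    by (simp add: Some a v excess_def algebra_simps)
qed

text \<open>
  The weight \<open>q\<close> is the probability that the site of a drop is closed. The exponential factors of the
  steps of a path multiply to \<open>z\<close> to the power of the total change of \<open>excess\<close>.
\<close>

definition weight :: "real \<Rightarrow> real \<Rightarrow> real \<Rightarrow> (nat \<Rightarrow> int) \<Rightarrow> step \<Rightarrow> real" where
  "weight q z \<alpha> \<eta> e = (if e = None then q else 1) * z powr gain \<alpha> \<eta> e"

lemma prod_weight:
  assumes "w \<in> lists (steps d)" and z: "z > 0"
  shows "(\<Prod>e\<leftarrow>w. weight q z \<alpha> \<eta> e)
    = q ^ count_list w None * z powr (excess \<alpha> d \<eta> (fold move w v) - excess \<alpha> d \<eta> v)"
  using assms(1)
proof (induction w arbitrary: v rule: list.induct)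
  case Nil
  then show ?case using z by simp
next
  case (Cons e w)
  have e: "e \<in> steps d" and w: "w \<in> lists (steps d)"
    using Cons.prems by auto
  have "(\<Prod>e\<leftarrow>e # w. weight q z \<alpha> \<eta> e) = weight q z \<alpha> \<eta> e * (q ^ count_list w None *
      z powr (excess \<alpha> d \<eta> (fold move w (move e v)) - excess \<alpha> d \<eta> (move e v)))"
    using Cons.IH[OF w] by simp
  also have "\<dots> = ((if e = None then q else 1) * q ^ count_list w None) *
      z powr (gain \<alpha> \<eta> e + (excess \<alpha> d \<eta> (fold move w (move e v)) - excess \<alpha> d \<eta> (move e v)))"
    unfolding weight_def powr_add by (simp add: mult_ac)
  also have "\<dots> = q ^ count_list (e # w) None * z powr (excess \<alpha> d \<eta> (fold move (e # w) v) - excess \<alpha> d \<eta> v)"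
    unfolding excess_move[OF e] by simp
  finally show ?case .
qed

text \<open>
  The vertical step contributes \<open>q z\<close>. The two steps along an axis with \<open>\<eta> j = 0\<close> contribute \<open>2 / z\<close>, and
  those along any other axis \<open>(z powr \<alpha> + z powr (-\<alpha>)) / z\<close>, where the second power is at most 1.
\<close>

lemma sum_weight_le:
  assumes \<eta>: "\<eta> \<in> tilts d" "l1_norm d \<eta> = int k" and z: "z \<ge> 1" and \<alpha>: "0 \<le> \<alpha>"
  shows "(\<Sum>e\<in>steps d. weight q z \<alpha> \<eta> e) \<le> q * z + (2 * real d + real k * z powr \<alpha>) / z"
proof -
  have two: "weight q z \<alpha> \<eta> (Some (j, 1)) + weight q z \<alpha> \<eta> (Some (j, -1))
      \<le> (2 + real_of_int \<bar>\<eta> j\<bar> * z powr \<alpha>) / z" if j: "j \<in> {1..d}" for j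
  proof -
    have "\<eta> j \<in> {-1, 0, 1}"
      using \<eta>(1) j by (auto simp: tilts_def PiE_iff)
    moreover have "z powr (\<alpha> - 1) = z powr \<alpha> / z" "z powr (- \<alpha> - 1) = z powr (-\<alpha>) / z" "z powr - 1 = 1 / z"
      using z by (simp_all add: powr_diff powr_minus_divide)
    moreover have "z powr (-\<alpha>) / z \<le> 1 / z"
      using z \<alpha> powr_mono[of "-\<alpha>" 0 z] by (intro divide_right_mono) auto
    moreover have "1 / z \<le> 2 / z"
      using z by (intro divide_right_mono) auto
    ultimately show ?thesis
      using z by (auto simp: weight_def add_divide_distrib)
  qed
  have "(\<Sum>e\<in>steps d. weight q z \<alpha> \<eta> e) = q * z + (\<Sum>e\<in>Some ` ({1..d} \<times> {-1, 1}). weight q z \<alpha> \<eta> e)"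
    unfolding steps_def using z by (subst sum.insert) (auto simp: weight_def)
  also have "(\<Sum>e\<in>Some ` ({1..d} \<times> {-1, 1}). weight q z \<alpha> \<eta> e) = (\<Sum>j=1..d. \<Sum>s\<in>{-1, 1}. weight q z \<alpha> \<eta> (Some (j, s)))"
    by (subst sum.cartesian_product) (simp add: sum.reindex case_prod_beta')
  also have "\<dots> = (\<Sum>j=1..d. weight q z \<alpha> \<eta> (Some (j, 1)) + weight q z \<alpha> \<eta> (Some (j, -1)))"
    by (simp add: add.commute)
  also have "\<dots> \<le> (\<Sum>j=1..d. (2 + real_of_int \<bar>\<eta> j\<bar> * z powr \<alpha>) / z)"
    by (intro sum_mono two)
  also have "\<dots> = (2 * real d + real_of_int (l1_norm d \<eta>) * z powr \<alpha>) / z"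
    by (simp add: sum_divide_distrib[symmetric] sum.distrib l1_norm_def sum_distrib_right)
  finally show ?thesis
    using \<eta>(2) by simp
qed

text \<open>
  The union bound over all paths with distinct drops. A path that ends at the hyperplane has final
  \<open>excess\<close> at least 0, so that the probability of its drops being closed is at most its total weight
  times \<open>z powr excess v\<close>. The total weight of all paths of length \<open>n\<close> is the \<open>n\<close>-th power of
  the weight of a single step, and the geometric series remains.
\<close>

lemma prob_reached_le:
  assumes \<eta>: "\<eta> \<in> tilts d" "l1_norm d \<eta> = int k" and z: "z \<ge> 1" and \<alpha>: "0 \<le> \<alpha>"
    and q: "q \<in> {0..1}" and r: "r = q * z + (2 * real d + real k * z powr \<alpha>) / z" "r < 1"
    and v: "fst v \<in> lattice_pts d"
    and L: "L = (\<lambda>x. \<lfloor>\<alpha> * real_of_int (\<Sum>i=1..d. \<eta> i * x i)\<rfloor>)"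
  shows "measure (site_perc (Suc d) (1 - q)) {\<omega> \<in> configs (Suc d). reached d L \<omega> v}
      \<le> z powr excess \<alpha> d \<eta> v / (1 - r)"
proof -
  let ?M = "site_perc (Suc d) (1 - q)"
  interpret prob_space ?M by (rule prob_space_site_perc)
  define Q where "Q = (\<lambda>n. {w. set w \<subseteq> steps d \<and> length w = n})"
  \<comment> \<open>Other words contribute nothing, which lets the union run over all words of a given length.\<close>
  define E where "E = (\<lambda>w. if descends d L v w \<and> distinct (drops v w)
      then {\<omega> \<in> configs (Suc d). \<forall>u\<in>set (drops v w). \<not> \<omega> (site d u)} else {})"
  have fin: "finite (steps d)" by (simp add: steps_def)
  have finQ: "finite (Q n)" for n
    unfolding Q_def by (rule finite_lists_length_eq[OF fin])
  have E_sets: "E w \<in> sets ?M" for w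
    unfolding E_def by (auto simp: descends_def intro!: drops_closed_event v)
  have r0: "0 \<le> r"
    using q z unfolding r by (auto intro!: add_nonneg_nonneg divide_nonneg_nonneg mult_nonneg_nonneg)
  have E_le: "prob (E w) \<le> z powr excess \<alpha> d \<eta> v * (\<Prod>e\<leftarrow>w. weight q z \<alpha> \<eta> e)" if w: "w \<in> lists (steps d)" for w
  proof (cases "descends d L v w \<and> distinct (drops v w)")
    case True
    have "0 \<le> excess \<alpha> d \<eta> (fold move w v)"
      using True unfolding descends_def L excess_def by (simp add: le_floor_iff)
    then have "1 \<le> z powr excess \<alpha> d \<eta> (fold move w v)"
      using z by (simp add: ge_one_powr_ge_zero)
    then have "q ^ count_list w None * 1 \<le> q ^ count_list w None * z powr excess \<alpha> d \<eta> (fold move w v)"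
      using q by (intro mult_left_mono) auto
    also have "\<dots> = z powr excess \<alpha> d \<eta> v * (\<Prod>e\<leftarrow>w. weight q z \<alpha> \<eta> e)"
      using z by (subst prod_weight[OF w, of _ _ _ _ v]) (auto simp: powr_diff)
    finally show ?thesis
      using True w q drops_closed_event(2)[OF w v, of "1 - q"] by (simp add: E_def)
  next
    case False
    have "0 \<le> (\<Prod>e\<leftarrow>w. weight q z \<alpha> \<eta> e)"
      using q by (intro prod_list_nonneg) (auto simp: weight_def)
    then show ?thesis
      using False by (auto simp: E_def)
  qed
  have level: "prob (\<Union>w\<in>Q n. E w) \<le> z powr excess \<alpha> d \<eta> v * r ^ n" for n
  proof -
    have "prob (\<Union>w\<in>Q n. E w) \<le> (\<Sum>w\<in>Q n. prob (E w))"
      using finQ E_sets by (intro finite_measure_subadditive_finite) auto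
    also have "\<dots> \<le> (\<Sum>w\<in>Q n. z powr excess \<alpha> d \<eta> v * (\<Prod>e\<leftarrow>w. weight q z \<alpha> \<eta> e))"
      by (intro sum_mono E_le) (auto simp: Q_def)
    also have "\<dots> = z powr excess \<alpha> d \<eta> v * (\<Sum>e\<in>steps d. weight q z \<alpha> \<eta> e) ^ n"
      unfolding Q_def sum_distrib_left[symmetric] sum_lists_prod[OF fin] ..
    also have "\<dots> \<le> z powr excess \<alpha> d \<eta> v * r ^ n"
      using q unfolding r(1)
      by (intro mult_left_mono power_mono sum_weight_le[OF \<eta> z \<alpha>] sum_nonneg) (auto simp: weight_def)
    finally show ?thesis .
  qed
  have "{\<omega> \<in> configs (Suc d). reached d L \<omega> v} \<subseteq> (\<Union>n. \<Union>w\<in>Q n. E w)"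
  proof
    fix \<omega> assume "\<omega> \<in> {\<omega> \<in> configs (Suc d). reached d L \<omega> v}"
    then obtain w where "\<omega> \<in> configs (Suc d)" "descends d L v w" "distinct (drops v w)" "\<forall>u\<in>set (drops v w). \<not> \<omega> (site d u)"
      using reached_distinct by blast
    then have "w \<in> Q (length w)" "\<omega> \<in> E w"
      by (auto simp: Q_def E_def descends_def)
    then show "\<omega> \<in> (\<Union>n. \<Union>w\<in>Q n. E w)" by blast
  qed
  then have "prob {\<omega> \<in> configs (Suc d). reached d L \<omega> v} \<le> prob (\<Union>n. \<Union>w\<in>Q n. E w)"
    using E_sets finQ by (intro finite_measure_mono) (auto intro!: sets.countable_UN sets.finite_UN)
  also have "\<dots> \<le> (\<Sum>n. prob (\<Union>w\<in>Q n. E w))"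
    using E_sets finQ level r0 r(2)
    by (intro finite_measure_subadditive_countably)
       (auto intro!: sets.finite_UN summable_comparison_test'[where g="\<lambda>n. z powr excess \<alpha> d \<eta> v * r ^ n" and N=0]
         summable_mult summable_geometric)
  also have "\<dots> \<le> (\<Sum>n. z powr excess \<alpha> d \<eta> v * r ^ n)"
    using level r0 r(2)
    by (intro suminf_le) (auto intro!: summable_comparison_test'[where g="\<lambda>n. z powr excess \<alpha> d \<eta> v * r ^ n" and N=0]
         summable_mult summable_geometric)
  also have "\<dots> = z powr excess \<alpha> d \<eta> v / (1 - r)"
    using r0 r(2) by (simp add: suminf_mult suminf_geometric summable_geometric)
  finally show ?thesis .
qed

text \<open>
  The bound on the probability that the site at height \<open>m\<close> is reached decays geometrically in \<open>m\<close>. By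
  the Borel--Cantelli lemma, almost surely only finitely many sites above each base point are reached.
\<close>

lemma LIP_almost_sure:
  assumes \<eta>: "\<eta> \<in> tilts d" "l1_norm d \<eta> = int k" and z: "z > 1" and \<alpha>: "0 \<le> \<alpha>"
    and q: "q \<in> {0..1}" and r: "q * z + (2 * real d + real k * z powr \<alpha>) / z < 1"
  shows "measure (site_perc (Suc d) (1 - q)) (LIP \<alpha> d \<eta>) = 1"
proof -
  let ?M = "site_perc (Suc d) (1 - q)"
  interpret prob_space ?M by (rule prob_space_site_perc)
  define r where "r = q * z + (2 * real d + real k * z powr \<alpha>) / z"
  define L where "L = (\<lambda>x. \<lfloor>\<alpha> * real_of_int (\<Sum>i=1..d. \<eta> i * x i)\<rfloor>)"
  have "AE \<omega> in ?M. \<forall>x\<in>lattice_pts d. \<forall>\<^sub>F m in sequentially. \<omega> \<in> space ?M - {\<omega> \<in> configs (Suc d). reached d L \<omega> (x, int m)}"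
  proof (subst AE_ball_countable[OF countable_lattice_pts], intro ballI)
    fix x assume x: "x \<in> lattice_pts d"
    let ?A = "\<lambda>m::nat. {\<omega> \<in> configs (Suc d). reached d L \<omega> (x, int m)}"
    let ?c = "z powr (\<alpha> * real_of_int (\<Sum>i=1..d. \<eta> i * x i)) / (1 - r)"
    have le: "prob (?A m) \<le> ?c * (1 / z) ^ m" for m
    proof -
      have "prob (?A m) \<le> z powr excess \<alpha> d \<eta> (x, int m) / (1 - r)"
        by (rule prob_reached_le[OF \<eta> _ \<alpha> q r_def _ _ L_def]) (use z x r in \<open>auto simp: r_def\<close>)
      also have "z powr excess \<alpha> d \<eta> (x, int m) = z powr (\<alpha> * real_of_int (\<Sum>i=1..d. \<eta> i * x i)) * (1 / z) ^ m"
        using z by (simp add: excess_def powr_diff powr_realpow power_divide)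
      finally show ?thesis by simp
    qed
    show "AE \<omega> in ?M. \<forall>\<^sub>F m in sequentially. \<omega> \<in> space ?M - ?A m"
    proof (rule borel_cantelli_AE1)
      show "summable (\<lambda>m. prob (?A m))"
      proof (rule summable_comparison_test'[where N=0])
        show "summable (\<lambda>m. ?c * (1 / z) ^ m)"
          using z by (intro summable_mult summable_geometric) auto
      qed (use le in auto)
    qed (use x in \<open>auto intro!: reached_event simp: less_top[symmetric]\<close>)
  qed
  then have "AE \<omega> in ?M. \<omega> \<in> LIP \<alpha> d \<eta>"
  proof (rule AE_mp, intro AE_I2 impI)
    fix \<omega> assume w: "\<omega> \<in> space ?M" and
      "\<forall>x\<in>lattice_pts d. \<forall>\<^sub>F m in sequentially. \<omega> \<in> space ?M - {\<omega> \<in> configs (Suc d). reached d L \<omega> (x, int m)}"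
    then have "\<forall>x\<in>lattice_pts d. \<exists>n::nat. \<forall>m\<ge>n. \<not> reached d L \<omega> (x, int m)"
      by (fastforce simp: eventually_sequentially space_site_perc)
    then show "\<omega> \<in> LIP \<alpha> d \<eta>"
      using w unfolding LIP_eq_lip_above L_def[symmetric] by (subst lip_above_iff_reached) (auto simp: space_site_perc)
  qed
  then show ?thesis
    by (rule prob_eq_1[THEN iffD2, rotated]) (simp add: LIP_eq_lip_above sets_lip_above)
qed

section \<open>The zero-one law\<close>

lemma configs_restrict [simp]: "(\<lambda>y\<in>lattice_pts n. f y) \<in> configs n"
  by (simp add: configs_def)

text \<open>
  Relabelling the sites preserves the measure. Translations and the symmetries of the lattice act on
  configurations in this way.
\<close>

lemma measure_site_perc_reindex_le:
  assumes g: "inj_on g (lattice_pts n)" "g \<in> lattice_pts n \<rightarrow> lattice_pts n"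
    and A: "A \<in> sets (site_perc n p)" "A' \<in> sets (site_perc n p)"
    and sub: "\<And>\<omega>. \<omega> \<in> A \<Longrightarrow> (\<lambda>y\<in>lattice_pts n. \<omega> (g y)) \<in> A'"
  shows "measure (site_perc n p) A \<le> measure (site_perc n p) A'"
proof -
  let ?M = "site_perc n p"
  let ?t = "\<lambda>\<omega>. \<lambda>y\<in>lattice_pts n. \<omega> (g y) :: bool"
  interpret prob_space ?M by (rule prob_space_site_perc)
  have distr: "distr ?M ?M ?t = ?M"
    unfolding site_perc_def by (rule distr_PiM_reindex) (use g in \<open>auto simp: measure_pmf.prob_space_axioms\<close>)
  have t: "?t \<in> measurable ?M ?M"
    unfolding site_perc_def using g by (intro measurable_restrict measurable_component_singleton) auto
  have "prob A \<le> prob (?t -` A' \<inter> space ?M)"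
    using sub sets.sets_into_space[OF A(1)] measurable_sets[OF t A(2)] by (intro finite_measure_mono) auto
  also have "\<dots> = measure (distr ?M ?M ?t) A'"
    by (rule measure_distr[symmetric]) (use t A in auto)
  finally show ?thesis
    unfolding distr .
qed

lemma lip_above_antimono:
  assumes "\<And>x. L x \<le> L' x"
  shows "lip_above d L' \<subseteq> lip_above d L"
  unfolding lip_above_def using assms by (blast intro: order.strict_trans1)

lemma lattice_pts_upd_Suc: "x \<in> lattice_pts d \<Longrightarrow> x(Suc d := h) \<in> lattice_pts (Suc d)"
  using site_in_lattice[of "(x, h)" d] by (simp add: site_Pair)

lemma measure_lip_above_shift_le:
  "measure (site_perc (Suc d) p) (lip_above d L) \<le> measure (site_perc (Suc d) p) (lip_above d (\<lambda>x. L x + n))"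
proof (rule measure_site_perc_reindex_le)
  let ?g = "\<lambda>y::nat \<Rightarrow> int. y(Suc d := y (Suc d) - n)"
  show "inj_on ?g (lattice_pts (Suc d))"
  proof (rule inj_onI, rule ext)
    fix y y' :: "nat \<Rightarrow> int" and i
    assume "?g y = ?g y'"
    from fun_cong[OF this, of i] show "y i = y' i"
      by (simp split: if_splits)
  qed
  show "?g \<in> lattice_pts (Suc d) \<rightarrow> lattice_pts (Suc d)"
    by (auto simp: lattice_pts_def PiE_iff extensional_def)
  fix \<omega> assume "\<omega> \<in> lip_above d L"
  then obtain F where "\<omega> \<in> configs (Suc d)" "lipschitz_fun d F"
    "\<And>x. x \<in> lattice_pts d \<Longrightarrow> \<omega> (x(Suc d := F x)) \<and> F x > L x"
    by (auto simp: lip_above_def)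
  then show "(\<lambda>y\<in>lattice_pts (Suc d). \<omega> (?g y)) \<in> lip_above d (\<lambda>x. L x + n)"
    unfolding lip_above_def
    by (auto simp: lattice_pts_upd_Suc lipschitz_fun_def intro!: exI[of _ "\<lambda>x. F x + n"])
qed (rule sets_lip_above)+

lemma measure_lip_above_shift:
  "measure (site_perc (Suc d) p) (lip_above d (\<lambda>x. L x + n)) = measure (site_perc (Suc d) p) (lip_above d L)"
  using measure_lip_above_shift_le[of d p L n] measure_lip_above_shift_le[of d p "\<lambda>x. L x + n" "- n"]
  by simp

text \<open>
  Raising the height function by a constant is a translation and does not change the probability, but
  it only shrinks the event. Once the constant is so large that no surface above the raised function
  can meet a given finite set of sites, the event does not depend on these sites, and the zero-one law
  for product measures applies.
\<close>

lemma lip_above_zero_one: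
  "measure (site_perc (Suc d) p) (lip_above d L) = 0 \<or> measure (site_perc (Suc d) p) (lip_above d L) = 1"
  unfolding site_perc_def
proof (rule zero_one_law_PiM, goal_cases)
  case (4 J)
  let ?M = "PiM (lattice_pts (Suc d)) (\<lambda>_. measure_pmf (bernoulli_pmf p))"
  \<comment> \<open>The raised function lies at or above every site of the finite set.\<close>
  define m where "m = (\<Sum>y\<in>J. \<bar>y (Suc d) - L (restrict y {1..d})\<bar>)"
  have m: "y (Suc d) \<le> L (restrict y {1..d}) + m" if "y \<in> J" for y
  proof -
    have "\<bar>y (Suc d) - L (restrict y {1..d})\<bar> \<le> m"
      unfolding m_def by (rule member_le_sum[OF that]) (use 4 in auto)
    then show ?thesis by linarith
  qed
  have "0 \<le> m"
    unfolding m_def by (rule sum_nonneg) simp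
  show ?case
  proof (intro bexI[of _ "lip_above d (\<lambda>x. L x + m)"] conjI ballI impI)
    show "lip_above d (\<lambda>x. L x + m) \<subseteq> lip_above d L"
      using \<open>0 \<le> m\<close> by (intro lip_above_antimono) simp
    show "measure ?M (lip_above d (\<lambda>x. L x + m)) = measure ?M (lip_above d L)"
      using measure_lip_above_shift[of d p L m] by (simp add: site_perc_def)
    show "lip_above d (\<lambda>x. L x + m) \<in> sets ?M"
      using sets_lip_above[of d _ p] by (simp add: site_perc_def)
    fix \<omega> \<omega>' assume w: "\<omega>' \<in> space ?M" "\<forall>y\<in>lattice_pts (Suc d) - J. \<omega> y = \<omega>' y"
      "\<omega> \<in> lip_above d (\<lambda>x. L x + m)"
    then obtain F where F: "lipschitz_fun d F"
      "\<And>x. x \<in> lattice_pts d \<Longrightarrow> \<omega> (x(Suc d := F x)) \<and> F x > L x + m"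
      by (auto simp: lip_above_def)
    have "\<omega>' (x(Suc d := F x))" if x: "x \<in> lattice_pts d" for x
    proof -
      have "restrict (x(Suc d := F x)) {1..d} = x"
        using x by (auto simp: lattice_pts_def PiE_iff extensional_def fun_eq_iff)
      then have "x(Suc d := F x) \<notin> J"
        using m[of "x(Suc d := F x)"] F(2)[OF x] by auto
      then show ?thesis
        using F(2)[OF x] w(2) lattice_pts_upd_Suc[OF x] by (metis DiffI)
    qed
    then show "\<omega>' \<in> lip_above d (\<lambda>x. L x + m)"
      using w(1) F unfolding lip_above_def
      by (auto simp: space_PiM configs_def)
  qed
next
  case 3
  show ?case
    using sets_lip_above[of d L p] by (simp add: site_perc_def)
qed (auto simp: measure_pmf.prob_space_axioms lattice_pts_nonempty)

section \<open>Monotonicity in the density\<close>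

lemma bool_pmf_eqI: "pmf \<mu> True = pmf \<nu> True \<Longrightarrow> \<mu> = \<nu>"
proof (rule pmf_eqI)
  fix b assume "pmf \<mu> True = pmf \<nu> True"
  then show "pmf \<mu> b = pmf \<nu> b"
    by (cases b) (auto simp: pmf_False_conv_True)
qed

text \<open>
  The usual monotone coupling, realised without uniform variables: a site is open at level \<open>p\<close> if it
  is open at level \<open>p'\<close> and an independent coin with success probability \<open>p / p'\<close> agrees.
\<close>

lemma measure_site_perc_mono:
  assumes p: "0 \<le> p" "p \<le> p'" "p' \<le> 1"
    and A: "\<And>p. A \<in> sets (site_perc n p)"
    and up: "\<And>\<omega> \<omega>'. \<omega> \<in> A \<Longrightarrow> \<omega>' \<in> configs n \<Longrightarrow> (\<And>y. y \<in> lattice_pts n \<Longrightarrow> \<omega> y \<Longrightarrow> \<omega>' y) \<Longrightarrow> \<omega>' \<in> A"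
  shows "measure (site_perc n p) A \<le> measure (site_perc n p') A"
proof (cases "p' = 0")
  case True
  then show ?thesis using p by simp
next
  case False
  \<comment> \<open>The first component decides openness at the larger parameter, both together at the smaller one.\<close>
  define \<mu> where "\<mu> = pair_pmf (bernoulli_pmf p') (bernoulli_pmf (p / p'))"
  let ?P = "PiM (lattice_pts n) (\<lambda>_. measure_pmf \<mu>)"
  interpret prob_space ?P
    by (intro prob_space_PiM) (simp add: measure_pmf.prob_space_axioms)
  let ?both = "\<lambda>(a, b). a \<and> b"
  have fst: "map_pmf fst \<mu> = bernoulli_pmf p'"
    by (simp add: \<mu>_def map_fst_pair_pmf)
  have both: "map_pmf ?both \<mu> = bernoulli_pmf p"
  proof (rule bool_pmf_eqI)
    have "?both -` {True} = {(True, True)}"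
      by auto
    then have "pmf (map_pmf ?both \<mu>) True = pmf \<mu> (True, True)"
      by (simp add: pmf_map measure_pmf_single)
    also have "\<dots> = p' * (p / p')"
      using p False unfolding \<mu>_def by (simp add: pmf_pair divide_le_eq)
    finally show "pmf (map_pmf ?both \<mu>) True = pmf (bernoulli_pmf p) True"
      using p False by simp
  qed
  have image: "measure (PiM (lattice_pts n) (\<lambda>_. measure_pmf (map_pmf f \<mu>))) A
      = prob ((\<lambda>\<omega>. \<lambda>i\<in>lattice_pts n. f (\<omega> i)) -` A \<inter> space ?P)"
    and meas: "(\<lambda>\<omega>. \<lambda>i\<in>lattice_pts n. f (\<omega> i)) -` A \<inter> space ?P \<in> events"
    if "A \<in> sets (PiM (lattice_pts n) (\<lambda>_. measure_pmf (map_pmf f \<mu>)))" for f :: "bool \<times> bool \<Rightarrow> bool"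
  proof -
    let ?Q = "PiM (lattice_pts n) (\<lambda>_. measure_pmf (map_pmf f \<mu>))"
    let ?t = "\<lambda>\<omega>. \<lambda>i\<in>lattice_pts n. f (\<omega> i)"
    have t: "?t \<in> measurable ?P ?Q"
      by (rule measurable_PiM_map_pmf)
    show "?t -` A \<inter> space ?P \<in> events"
      using t that by (rule measurable_sets)
    show "measure ?Q A = prob (?t -` A \<inter> space ?P)"
      using measure_distr[OF t that] unfolding distr_PiM_map_pmf .
  qed
  have "measure (site_perc n p) A = prob ((\<lambda>\<omega>. \<lambda>i\<in>lattice_pts n. ?both (\<omega> i)) -` A \<inter> space ?P)"
    unfolding site_perc_def both[symmetric] using A[of p]
    by (intro image) (simp add: site_perc_def both)
  also have "\<dots> \<le> prob ((\<lambda>\<omega>. \<lambda>i\<in>lattice_pts n. fst (\<omega> i)) -` A \<inter> space ?P)"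
  proof (rule finite_measure_mono)
    show "(\<lambda>\<omega>. \<lambda>i\<in>lattice_pts n. fst (\<omega> i)) -` A \<inter> space ?P \<in> events"
      using A[of p'] by (intro meas) (simp add: site_perc_def fst)
    show "(\<lambda>\<omega>. \<lambda>i\<in>lattice_pts n. ?both (\<omega> i)) -` A \<inter> space ?P
        \<subseteq> (\<lambda>\<omega>. \<lambda>i\<in>lattice_pts n. fst (\<omega> i)) -` A \<inter> space ?P"
    proof
      fix \<omega> assume w: "\<omega> \<in> (\<lambda>\<omega>. \<lambda>i\<in>lattice_pts n. ?both (\<omega> i)) -` A \<inter> space ?P"
      then have "(\<lambda>i\<in>lattice_pts n. fst (\<omega> i)) \<in> A"
        by - (rule up[of "\<lambda>i\<in>lattice_pts n. ?both (\<omega> i)"], auto simp: case_prod_beta)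
      then show "\<omega> \<in> (\<lambda>\<omega>. \<lambda>i\<in>lattice_pts n. fst (\<omega> i)) -` A \<inter> space ?P"
        using w by simp
    qed
  qed
  also have "\<dots> = measure (site_perc n p') A"
    unfolding site_perc_def fst[symmetric] using A[of p']
    by (intro image[symmetric]) (simp add: site_perc_def fst)
  finally show ?thesis .
qed

lemma measure_lip_above_mono:
  assumes "0 \<le> p" "p \<le> p'" "p' \<le> 1"
  shows "measure (site_perc (Suc d) p) (lip_above d L) \<le> measure (site_perc (Suc d) p') (lip_above d L)"
proof (rule measure_site_perc_mono[OF assms sets_lip_above])
  fix \<omega> \<omega>' assume "\<omega> \<in> lip_above d L" "\<omega>' \<in> configs (Suc d)"
    "\<And>y. y \<in> lattice_pts (Suc d) \<Longrightarrow> \<omega> y \<Longrightarrow> \<omega>' y"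
  then show "\<omega>' \<in> lip_above d L"
    unfolding lip_above_def using lattice_pts_upd_Suc by blast
qed

section \<open>Absence of surfaces at low density\<close>

definition axis_pt :: "nat \<Rightarrow> nat \<Rightarrow> nat \<Rightarrow> int" where
  "axis_pt d j = (\<lambda>i\<in>{1..d}. if i = 1 then int j else 0)"

lemma axis_pt_in_lattice: "axis_pt d j \<in> lattice_pts d"
  by (simp add: axis_pt_def lattice_pts_def)

lemma axis_pt_neighbour:
  assumes "1 \<le> d"
  shows "l1_norm d (\<lambda>i. axis_pt d (Suc j) i - axis_pt d j i) = 1"
proof -
  have "l1_norm d (\<lambda>i. axis_pt d (Suc j) i - axis_pt d j i) = (\<Sum>i=1..d. if i = 1 then 1 else 0)"
    unfolding l1_norm_def by (intro sum.cong) (auto simp: axis_pt_def)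
  then show ?thesis using assms by simp
qed

text \<open>
  Above the first coordinate axis a Lipschitz surface is a path that has three choices at each step. For every
  starting height the expected number of open paths of length \<open>n\<close> is at most \<open>(3 p) ^ n\<close>, which
  tends to 0, and there are countably many starting heights. This keeps the critical probability
  away from 0.
\<close>

lemma lip_above_null:
  assumes p: "0 \<le> p" "p < 1 / 3" and d: "1 \<le> d"
  shows "measure (site_perc (Suc d) p) (lip_above d L) = 0"
proof -
  let ?M = "site_perc (Suc d) p"
  interpret prob_space ?M by (rule prob_space_site_perc)
  \<comment> \<open>The path above the first axis that starts at height \<open>h\<close> and has increments \<open>ds\<close>.\<close>
  define S where "S = (\<lambda>h ds. (\<lambda>j. (axis_pt d j)(Suc d := h + sum_list (take j ds))) ` {..<length ds})"
  define Q where "Q = (\<lambda>n. {ds::int list. set ds \<subseteq> {-1, 0, 1} \<and> length ds = n})"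
  define E where "E = (\<lambda>h ds. {\<omega> \<in> configs (Suc d). \<forall>y\<in>S h ds. \<omega> y = True})"
  define D where "D = (\<lambda>h. \<Inter>n. \<Union>ds\<in>Q n. E h ds)"
  have finQ: "finite (Q n)" and cardQ: "card (Q n) = 3 ^ n" for n
    unfolding Q_def by (auto simp: finite_lists_length_eq card_lists_length_eq numeral_3_eq_3)
  have S: "finite (S h ds)" "S h ds \<subseteq> lattice_pts (Suc d)" for h ds
    unfolding S_def by (auto intro!: lattice_pts_upd_Suc axis_pt_in_lattice)
  have "inj_on (\<lambda>j. (axis_pt d j)(Suc d := h + sum_list (take j ds))) {..<length ds}" for h and ds :: "int list"
  proof (rule inj_onI)
    fix j j' assume "(axis_pt d j)(Suc d := h + sum_list (take j ds)) = (axis_pt d j')(Suc d := h + sum_list (take j' ds))"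
    from fun_cong[OF this, of 1] show "j = j'"
      using d by (simp add: axis_pt_def)
  qed
  then have cardS: "card (S h ds) = length ds" for h ds
    unfolding S_def by (simp add: card_image)
  have E_sets: "E h ds \<in> events" for h ds
    unfolding E_def by (rule site_perc_all_equal[OF S])
  have D_sets: "D h \<in> events" for h
    unfolding D_def using E_sets finQ by (intro sets.countable_INT sets.finite_UN) auto
  have "prob (D h) = 0" for h
  proof -
    have "prob (D h) \<le> (3 * p) ^ n" for n
    proof -
      have "prob (D h) \<le> prob (\<Union>ds\<in>Q n. E h ds)"
        using E_sets finQ by (intro finite_measure_mono sets.finite_UN) (auto simp: D_def)
      also have "\<dots> \<le> (\<Sum>ds\<in>Q n. prob (E h ds))"
        using finQ E_sets by (intro finite_measure_subadditive_finite) auto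
      also have "\<dots> = (\<Sum>ds\<in>Q n. p ^ n)"
        unfolding E_def site_perc_all_equal(2)[OF S] cardS using p
        by (intro sum.cong) (auto simp: Q_def)
      also have "\<dots> = (3 * p) ^ n"
        by (simp add: cardQ power_mult_distrib)
      finally show ?thesis .
    qed
    moreover have "(\<lambda>n. (3 * p) ^ n) \<longlonglongrightarrow> 0"
      using p by (intro LIMSEQ_realpow_zero) auto
    ultimately have "prob (D h) \<le> 0"
      by (intro LIMSEQ_le_const) auto
    then show ?thesis
      by (simp add: measure_le_0_iff)
  qed
  then have "(\<Union>h. D h) \<in> null_sets ?M"
    using D_sets by (intro null_sets_UN) (auto simp: null_sets_def emeasure_eq_measure)
  moreover have "lip_above d L \<subseteq> (\<Union>h. D h)"
  proof
    fix \<omega> assume "\<omega> \<in> lip_above d L"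
    then obtain F where w: "\<omega> \<in> configs (Suc d)" and F: "lipschitz_fun d F"
      "\<And>x. x \<in> lattice_pts d \<Longrightarrow> \<omega> (x(Suc d := F x))"
      by (auto simp: lip_above_def)
    define f where "f = (\<lambda>j. F (axis_pt d j))"
    have "\<bar>f (Suc j) - f j\<bar> \<le> 1" for j
      using F(1) axis_pt_in_lattice axis_pt_neighbour[OF d] unfolding lipschitz_fun_def f_def by blast
    then have f: "f (Suc j) - f j \<in> {-1, 0, 1}" for j
      by (simp add: abs_le_iff) (smt (verit, del_insts))
    \<comment> \<open>The increments of the surface along the axis determine its heights.\<close>
    have tele: "f 0 + sum_list (map (\<lambda>j. f (Suc j) - f j) [0..<n]) = f n" for n
      by (induction n) auto
    have "\<omega> \<in> (\<Union>ds\<in>Q n. E (f 0) ds)" for n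
    proof (rule UN_I)
      let ?ds = "map (\<lambda>j. f (Suc j) - f j) [0..<n]"
      have "set ?ds \<subseteq> {-1, 0, 1}"
        unfolding set_map by (rule image_subsetI) (rule f)
      then show "?ds \<in> Q n"
        unfolding Q_def by simp
      have "\<omega> ((axis_pt d j)(Suc d := f 0 + sum_list (take j ?ds)))" if "j < n" for j
        using that F(2)[OF axis_pt_in_lattice, of j] tele[of j] by (simp add: take_map f_def)
      then show "\<omega> \<in> E (f 0) ?ds"
        using w by (auto simp: E_def S_def)
    qed
    then show "\<omega> \<in> (\<Union>h. D h)"
      by (auto simp: D_def)
  qed
  ultimately have "lip_above d L \<in> null_sets ?M"
    by (rule null_sets_subset[OF _ sets_lip_above])
  then show ?thesis
    by (simp add: null_sets_def measure_def)
qed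

section \<open>Dependence on the tilt\<close>

text \<open>
  Two tilts with the same number of nonzero entries differ by a permutation of the axes and by
  reflections.
\<close>

lemma tilts_sign_permutation:
  assumes \<eta>: "\<eta> \<in> tilts d" "\<eta>' \<in> tilts d" "l1_norm d \<eta> = l1_norm d \<eta>'"
  shows "\<exists>\<tau> t. bij_betw \<tau> {1..d} {1..d} \<and> (\<forall>j\<in>{1..d}. t j \<in> {-1, 1} \<and> \<eta> j = t j * \<eta>' (\<tau> j))"
proof -
  have vals: "\<eta> j \<in> {-1, 0, 1}" "\<eta>' j \<in> {-1, 0, 1}" if "j \<in> {1..d}" for j
    using \<eta>(1,2) that by (auto simp: tilts_def PiE_iff)
  have card: "l1_norm d \<zeta> = int (card {i\<in>{1..d}. \<zeta> i \<noteq> 0})" if "\<zeta> \<in> tilts d" for \<zeta>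
  proof -
    have "l1_norm d \<zeta> = (\<Sum>i=1..d. if \<zeta> i \<noteq> 0 then 1 else 0)"
      unfolding l1_norm_def
    proof (rule sum.cong[OF refl])
      fix i assume "i \<in> {1..d}"
      then have "\<zeta> i \<in> {-1, 0, 1}"
        using that by (auto simp: tilts_def)
      then show "\<bar>\<zeta> i\<bar> = (if \<zeta> i \<noteq> 0 then 1 else 0)"
        by auto
    qed
    also have "\<dots> = int (card {i\<in>{1..d}. \<zeta> i \<noteq> 0})"
      by (simp add: sum.If_cases Int_def)
    finally show ?thesis .
  qed
  let ?S = "{i\<in>{1..d}. \<eta> i \<noteq> 0}" and ?S' = "{i\<in>{1..d}. \<eta>' i \<noteq> 0}"
  have cards: "card ?S = card ?S'"
    using \<eta> card[of \<eta>] card[of \<eta>'] by simp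
  moreover have "card ({1..d} - ?S) = card ({1..d} - ?S')"
    using cards by (subst (1 2) card_Diff_subset) auto
  ultimately obtain f g where fg: "bij_betw f ?S ?S'" "bij_betw g ({1..d} - ?S) ({1..d} - ?S')"
    using finite_same_card_bij[of ?S ?S'] finite_same_card_bij[of "{1..d} - ?S" "{1..d} - ?S'"] by auto
  define \<tau> where "\<tau> = (\<lambda>j. if j \<in> ?S then f j else g j)"
  define t where "t = (\<lambda>j. if j \<in> ?S then \<eta> j * \<eta>' (\<tau> j) else 1)"
  have \<tau>S: "bij_betw \<tau> ?S ?S'" "bij_betw \<tau> ({1..d} - ?S) ({1..d} - ?S')"
    using fg bij_betw_cong[of ?S \<tau> f ?S'] bij_betw_cong[of "{1..d} - ?S" \<tau> g "{1..d} - ?S'"]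
    unfolding \<tau>_def by (simp_all only: DiffE if_True if_False simp_thms Diff_iff)
  have "bij_betw \<tau> (?S \<union> ({1..d} - ?S)) (?S' \<union> ({1..d} - ?S'))"
    by (rule bij_betw_combine[OF \<tau>S]) auto
  moreover have "?S \<union> ({1..d} - ?S) = {1..d}" "?S' \<union> ({1..d} - ?S') = {1..d}"
    by auto
  ultimately have bij: "bij_betw \<tau> {1..d} {1..d}"
    by (simp only:)
  have on: "\<tau> j \<in> ?S'" if "j \<in> ?S" for j
    using bij_betwE[OF \<tau>S(1)] that by (rule bspec)
  have off: "\<tau> j \<in> {1..d} - ?S'" if "j \<in> {1..d} - ?S" for j
    using bij_betwE[OF \<tau>S(2)] that by (rule bspec)
  have "t j \<in> {-1, 1} \<and> \<eta> j = t j * \<eta>' (\<tau> j)" if j: "j \<in> {1..d}" for j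
  proof (cases "j \<in> ?S")
    case True
    then have "\<eta> j \<in> {-1, 1}" "\<eta>' (\<tau> j) \<in> {-1, 1}"
      using vals[of j] vals[of "\<tau> j"] on[OF True] by auto
    then show ?thesis
      using True by (auto simp: t_def)
  next
    case False
    then show ?thesis
      using off[of j] j by (auto simp: t_def)
  qed
  then show ?thesis
    using bij by blast
qed

text \<open>
  The signed permutation that carries one tilt to the other, extended by the identity on heights,
  preserves Lipschitz functions and turns one tilted hyperplane into the other.
\<close>

lemma measure_LIP_le_tilt:
  assumes \<eta>: "\<eta> \<in> tilts d" "\<eta>' \<in> tilts d" "l1_norm d \<eta> = l1_norm d \<eta>'"
  shows "measure (site_perc (Suc d) p) (LIP \<alpha> d \<eta>) \<le> measure (site_perc (Suc d) p) (LIP \<alpha> d \<eta>')"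
proof -
  obtain \<tau> t where \<tau>: "bij_betw \<tau> {1..d} {1..d}"
    and signs: "\<forall>j\<in>{1..d}. t j \<in> {-1, 1} \<and> \<eta> j = t j * \<eta>' (\<tau> j)"
    using tilts_sign_permutation[OF \<eta>] by (elim exE conjE)
  have t: "t j \<in> {-1, 1}" and eq: "\<eta> j = t j * \<eta>' (\<tau> j)" if "j \<in> {1..d}" for j
    using bspec[OF signs that] by (rule conjunct1, rule conjunct2)
  have \<tau>_in: "\<tau> j \<in> {1..d}" if "j \<in> {1..d}" for j
    using bij_betwE[OF \<tau>] that by blast
  define T where "T = (\<lambda>x. \<lambda>j\<in>{1..d}. t j * x (\<tau> j))"
  let ?g = "\<lambda>y. (T y)(Suc d := y (Suc d))"
  have T_in: "T x \<in> lattice_pts d" for x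
    by (simp add: T_def lattice_pts_def)
  have T_upd: "T (x(Suc d := h)) = T x" for x h
    unfolding T_def
  proof (rule restrict_ext)
    fix j assume "j \<in> {1..d}"
    from \<tau>_in[OF this] have "\<tau> j \<noteq> Suc d"
      by auto
    then show "t j * (x(Suc d := h)) (\<tau> j) = t j * x (\<tau> j)"
      by simp
  qed
  have sum_T: "(\<Sum>i=1..d. \<eta> i * T x i) = (\<Sum>i=1..d. \<eta>' i * x i)" for x
  proof -
    have "(\<Sum>j=1..d. \<eta> j * T x j) = (\<Sum>j=1..d. \<eta>' (\<tau> j) * x (\<tau> j))"
    proof (rule sum.cong[OF refl])
      fix j assume j: "j \<in> {1..d}"
      have "t j * t j = 1"
        using t[OF j] by auto
      moreover have "\<eta> j * T x j = (t j * t j) * (\<eta>' (\<tau> j) * x (\<tau> j))"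
        using j by (simp add: T_def eq[OF j])
      ultimately show "\<eta> j * T x j = \<eta>' (\<tau> j) * x (\<tau> j)"
        by simp
    qed
    also have "\<dots> = (\<Sum>i=1..d. \<eta>' i * x i)"
      by (rule sum.reindex_bij_betw[OF \<tau>])
    finally show ?thesis .
  qed
  have norm_T: "l1_norm d (\<lambda>i. T x i - T y i) = l1_norm d (\<lambda>i. x i - y i)" for x y
  proof -
    have "l1_norm d (\<lambda>i. T x i - T y i) = (\<Sum>j=1..d. \<bar>x (\<tau> j) - y (\<tau> j)\<bar>)"
      unfolding l1_norm_def
    proof (rule sum.cong[OF refl])
      fix j assume "j \<in> {1..d}"
      then show "\<bar>T x j - T y j\<bar> = \<bar>x (\<tau> j) - y (\<tau> j)\<bar>"
        using t[of j] by (auto simp: T_def)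
    qed
    also have "\<dots> = l1_norm d (\<lambda>i. x i - y i)"
      unfolding l1_norm_def by (rule sum.reindex_bij_betw[OF \<tau>])
    finally show ?thesis .
  qed
  show ?thesis
    unfolding LIP_eq_lip_above
  proof (rule measure_site_perc_reindex_le)
    show "inj_on ?g (lattice_pts (Suc d))"
    proof (rule inj_onI, rule ext)
      fix y y' i
      assume y: "y \<in> lattice_pts (Suc d)" "y' \<in> lattice_pts (Suc d)" and g: "?g y = ?g y'"
      consider "i = Suc d" | "i \<in> {1..d}" | "i \<notin> {1..Suc d}"
        by fastforce
      then show "y i = y' i"
      proof cases
        case 1
        then show ?thesis using fun_cong[OF g, of i] by simp
      next
        case 2
        then obtain j where j: "j \<in> {1..d}" "i = \<tau> j"
          using bij_betw_imp_surj_on[OF \<tau>] by blast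
        then show ?thesis
          using fun_cong[OF g, of j] t[OF j(1)] by (auto simp: T_def)
      next
        case 3
        then show ?thesis using y by (auto simp: lattice_pts_def PiE_iff extensional_def)
      qed
    qed
    show "?g \<in> lattice_pts (Suc d) \<rightarrow> lattice_pts (Suc d)"
      using T_in lattice_pts_upd_Suc by blast
    fix \<omega> assume "\<omega> \<in> lip_above d (\<lambda>x. \<lfloor>\<alpha> * real_of_int (\<Sum>i=1..d. \<eta> i * x i)\<rfloor>)"
    then obtain F where F: "lipschitz_fun d F" and open_F: "\<And>x. x \<in> lattice_pts d \<Longrightarrow> \<omega> (x(Suc d := F x))"
      and above: "\<And>x. x \<in> lattice_pts d \<Longrightarrow> F x > \<lfloor>\<alpha> * real_of_int (\<Sum>i=1..d. \<eta> i * x i)\<rfloor>"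
      by (auto simp: lip_above_def)
    have lip_T: "lipschitz_fun d (\<lambda>x. F (T x))"
      using F T_in norm_T unfolding lipschitz_fun_def by metis
    have open_T: "(\<lambda>y\<in>lattice_pts (Suc d). \<omega> (?g y)) (x(Suc d := F (T x)))" if "x \<in> lattice_pts d" for x
      using open_F[OF T_in, of x] lattice_pts_upd_Suc[OF that] by (simp add: T_upd)
    have above_T: "F (T x) > \<lfloor>\<alpha> * real_of_int (\<Sum>i=1..d. \<eta>' i * x i)\<rfloor>" for x
      using above[OF T_in, of x] unfolding sum_T .
    show "(\<lambda>y\<in>lattice_pts (Suc d). \<omega> (?g y)) \<in> lip_above d (\<lambda>x. \<lfloor>\<alpha> * real_of_int (\<Sum>i=1..d. \<eta>' i * x i)\<rfloor>)"
      unfolding lip_above_def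
      by (intro CollectI conjI exI[of _ "\<lambda>x. F (T x)"] ballI configs_restrict lip_T open_T above_T)
  qed (rule sets_lip_above)+
qed

lemma measure_LIP_tilt_cong:
  assumes "\<eta> \<in> tilts d" "\<eta>' \<in> tilts d" "l1_norm d \<eta> = l1_norm d \<eta>'"
  shows "measure (site_perc (Suc d) p) (LIP \<alpha> d \<eta>) = measure (site_perc (Suc d) p) (LIP \<alpha> d \<eta>')"
  using measure_LIP_le_tilt assms by (intro antisym) auto

section \<open>The critical probability\<close>

lemma ex_subcritical_parameter:
  assumes "0 \<le> \<alpha>" "\<alpha> < 1"
  shows "\<exists>z>1. (2 * real d + real k * z powr \<alpha>) / z < 1"
proof -
  have "((\<lambda>z. 2 * real d * z powr (-1) + real k * z powr (\<alpha> - 1)) \<longlongrightarrow> 2 * real d * 0 + real k * 0) at_top"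
    using assms by (intro tendsto_intros tendsto_neg_powr filterlim_ident) auto
  then have "eventually (\<lambda>z. 2 * real d * z powr (-1) + real k * z powr (\<alpha> - 1) < 1) at_top"
    by (auto dest: order_tendstoD(2)[where a = 1])
  then have "eventually (\<lambda>z. z > 1 \<and> 2 * real d * z powr (-1) + real k * z powr (\<alpha> - 1) < 1) at_top"
    using eventually_gt_at_top[of 1] by (rule eventually_conj[rotated])
  then obtain z where z: "z > 1" "2 * real d * z powr (-1) + real k * z powr (\<alpha> - 1) < 1"
    using eventually_happens'[OF trivial_limit_at_top_linorder] by blast
  then have "2 * real d * z powr (-1) + real k * z powr (\<alpha> - 1) = (2 * real d + real k * z powr \<alpha>) / z"
    by (simp add: powr_diff powr_minus_divide add_divide_distrib)
  then show ?thesis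
    using z by auto
qed

text \<open>
  The probability of the event is monotone in \<open>p\<close> and takes only the values 0 and 1, so it jumps once,
  at the supremum of the parameters where it vanishes. The jump is not at 0 because the event is null
  for small \<open>p\<close>, and not at 1 because the path bound applies to a small positive density of closed
  sites.
\<close>

lemma is_critical_prob_unique_exists:
  assumes d: "1 \<le> d" and \<alpha>: "0 \<le> \<alpha>" "\<alpha> < 1" and \<eta>: "\<eta> \<in> tilts d" "l1_norm d \<eta> = int k"
  shows "\<exists>!pc. is_critical_prob \<alpha> d \<eta> pc"
proof -
  define f where "f = (\<lambda>p. measure (site_perc (Suc d) p) (LIP \<alpha> d \<eta>))"
  have f_eq: "measure (site_perc (Suc d) p) (LIP \<alpha> d \<eta>) = f p" for p
    by (simp add: f_def)
  have f01: "f p = 0 \<or> f p = 1" for p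
    unfolding f_def LIP_eq_lip_above by (rule lip_above_zero_one)
  have mono: "f p \<le> f p'" if "0 \<le> p" "p \<le> p'" "p' \<le> 1" for p p'
    unfolding f_def LIP_eq_lip_above using that by (rule measure_lip_above_mono)
  have f0: "f (1 / 4) = 0"
    unfolding f_def LIP_eq_lip_above using d by (intro lip_above_null) auto
  obtain z where z: "z > 1" "(2 * real d + real k * z powr \<alpha>) / z < 1"
    using ex_subcritical_parameter[OF \<alpha>] by blast
  define r where "r = (2 * real d + real k * z powr \<alpha>) / z"
  define q where "q = (1 - r) / (2 * z)"
  have r: "0 \<le> r" "r < 1"
    using z by (auto simp: r_def)
  have q: "0 < q" "q \<le> 1"
    using z r by (auto simp: q_def divide_le_eq)
  have f1: "f (1 - q) = 1"
    unfolding f_def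
  proof (rule LIP_almost_sure[OF \<eta> z(1) \<alpha>(1)])
    have "q * z = (1 - r) / 2"
      using z by (simp add: q_def)
    then show "q * z + (2 * real d + real k * z powr \<alpha>) / z < 1"
      using r unfolding r_def[symmetric] by simp
  qed (use q in auto)
  define Z where "Z = {p \<in> {0..1}. f p = 0}"
  have Z_le: "p \<le> 1 - q" if "p \<in> Z" for p
  proof (rule ccontr)
    assume "\<not> p \<le> 1 - q"
    then have "f (1 - q) \<le> f p"
      using that q by (intro mono) (auto simp: Z_def)
    then show False
      using f1 that by (simp add: Z_def)
  qed
  have bdd: "bdd_above Z"
    using Z_le by (rule bdd_aboveI)
  have Z4: "1 / 4 \<in> Z"
    using f0 by (simp add: Z_def)
  have "is_critical_prob \<alpha> d \<eta> (Sup Z)"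
    unfolding is_critical_prob_def f_eq
  proof (intro conjI ballI impI)
    show "0 < Sup Z"
      using cSup_upper[OF Z4 bdd] by simp
    have "Sup Z \<le> 1 - q"
      using Z4 Z_le by (intro cSup_least) auto
    then show "Sup Z < 1"
      using q by simp
  next
    fix p :: real assume p: "p \<in> {0..1}" "p < Sup Z"
    then obtain p' where "p' \<in> Z" "p < p'"
      using less_cSupD[of Z p] Z4 by blast
    then have "f p \<le> 0"
      using mono[of p p'] p by (simp add: Z_def)
    then show "f p = 0"
      using f01[of p] by auto
  next
    fix p :: real assume p: "p \<in> {0..1}" "Sup Z < p"
    then have "p \<notin> Z"
      using cSup_upper[OF _ bdd] by force
    then show "f p = 1"
      using p f01[of p] by (auto simp: Z_def)
  qed
  moreover have "\<not> a < b" if "is_critical_prob \<alpha> d \<eta> a" "is_critical_prob \<alpha> d \<eta> b" for a b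
  proof
    assume "a < b"
    then have "(a + b) / 2 \<in> {0..1}" "a < (a + b) / 2" "(a + b) / 2 < b"
      using that unfolding is_critical_prob_def by (simp_all add: field_simps)
    then have "f ((a + b) / 2) = 1" "f ((a + b) / 2) = 0"
      using that unfolding is_critical_prob_def f_eq by blast+
    then show False by simp
  qed
  ultimately show ?thesis
    by (intro ex_ex1I) (blast, metis linorder_neqE)
qed

lemma ex_tilt:
  assumes "k \<le> d"
  obtains \<eta> where "\<eta> \<in> tilts d" "l1_norm d \<eta> = int k"
proof
  let ?\<eta> = "\<lambda>i\<in>{1..d}. if i \<le> k then 1 else 0 :: int"
  show "?\<eta> \<in> tilts d"
    by (auto simp: tilts_def)
  have "l1_norm d ?\<eta> = (\<Sum>i\<in>{1..d}. if i \<le> k then 1 else 0)"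
    unfolding l1_norm_def by (rule sum.cong) auto
  also have "\<dots> = int (card ({1..d} \<inter> {i. i \<le> k}))"
    by (simp add: sum.If_cases)
  also have "{1..d} \<inter> {i. i \<le> k} = {1..k}"
    using assms by auto
  also have "int (card {1..k}) = int k"
    by simp
  finally show "l1_norm d ?\<eta> = int k" .
qed

text \<open>
  The definite description behind \<open>p_L\<close> denotes something because the critical probabilities of
  all tilts with the same norm coincide.
\<close>

lemma is_critical_prob_p_L:
  assumes d: "1 \<le> d" and \<alpha>: "0 \<le> \<alpha>" "\<alpha> < 1" and \<eta>: "\<eta> \<in> tilts d" "l1_norm d \<eta> = int k"
  shows "is_critical_prob \<alpha> d \<eta> (p_L \<alpha> d k)"
proof -
  have tilt_eq: "p_L_tilt \<alpha> d \<eta>' = p_L_tilt \<alpha> d \<eta>" if "\<eta>' \<in> tilts d" "l1_norm d \<eta>' = int k" for \<eta>'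
  proof -
    have "measure (site_perc (Suc d) p) (LIP \<alpha> d \<eta>') = measure (site_perc (Suc d) p) (LIP \<alpha> d \<eta>)" for p
      using \<eta> that by (intro measure_LIP_tilt_cong) auto
    then show ?thesis
      by (simp add: p_L_tilt_def is_critical_prob_def)
  qed
  have "p_L \<alpha> d k = p_L_tilt \<alpha> d \<eta>"
    unfolding p_L_def
  proof (rule the_equality)
    show "\<forall>\<eta>'\<in>tilts d. l1_norm d \<eta>' = int k \<longrightarrow> p_L_tilt \<alpha> d \<eta>' = p_L_tilt \<alpha> d \<eta>"
      by (intro ballI impI tilt_eq)
  next
    fix pc assume "\<forall>\<eta>'\<in>tilts d. l1_norm d \<eta>' = int k \<longrightarrow> p_L_tilt \<alpha> d \<eta>' = pc"
    then show "pc = p_L_tilt \<alpha> d \<eta>"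
      using \<eta> by blast
  qed
  then show ?thesis
    using theI'[OF is_critical_prob_unique_exists[OF d \<alpha> \<eta>]] by (simp add: p_L_tilt_def)
qed

text \<open>
  If \<open>q\<close> is below the bound, the total weight of a step is less than 1 at density \<open>q\<close> of closed
  sites, so that a surface exists almost surely and \<open>1 - q\<close> is not below the critical probability.
\<close>

lemma q_L_ge:
  assumes d: "1 \<le> d" and k: "k \<le> d" and \<alpha>: "0 \<le> \<alpha>" "\<alpha> < 1" and z: "z > 1"
  shows "(1 - (2 * real d + real k * z powr \<alpha>) / z) / z \<le> q_L \<alpha> d k"
proof -
  obtain \<eta> where \<eta>: "\<eta> \<in> tilts d" "l1_norm d \<eta> = int k"
    using ex_tilt[OF k] .
  have crit: "is_critical_prob \<alpha> d \<eta> (p_L \<alpha> d k)"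
    by (rule is_critical_prob_p_L[OF d \<alpha> \<eta>])
  then have pos: "0 < q_L \<alpha> d k"
    by (simp add: is_critical_prob_def q_L_def)
  let ?r = "(2 * real d + real k * z powr \<alpha>) / z"
  show ?thesis
  proof (rule dense_le)
    fix q assume q: "q < (1 - ?r) / z"
    have "0 \<le> ?r"
      using z by auto
    then have "(1 - ?r) / z \<le> 1"
      using z \<open>0 \<le> ?r\<close> by (subst pos_divide_le_eq) linarith+
    show "q \<le> q_L \<alpha> d k"
    proof (rule ccontr)
      assume less: "\<not> q \<le> q_L \<alpha> d k"
      have q01: "q \<in> {0..1}"
        using less pos q \<open>(1 - ?r) / z \<le> 1\<close> by auto
      have "q * z + ?r < 1"
        using q z by (simp add: less_divide_eq)
      then have "measure (site_perc (Suc d) (1 - q)) (LIP \<alpha> d \<eta>) = 1"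
        by (rule LIP_almost_sure[OF \<eta> z \<alpha>(1) q01])
      moreover have "1 - q < p_L \<alpha> d k"
        using less by (simp add: q_L_def)
      ultimately show False
        using crit q01 by (simp add: is_critical_prob_def)
    qed
  qed
qed

section \<open>High dimensions\<close>

lemma asymp_geI:
  assumes "eventually (\<lambda>d. b d \<le> f d / g d) sequentially" and "b \<longlonglongrightarrow> l" and "1 \<le> l"
  shows "f \<greatersim> g"
proof -
  have "liminf (\<lambda>d. ereal (b d)) = ereal l"
    using assms(2) by (intro lim_imp_Liminf) auto
  moreover have "liminf (\<lambda>d. ereal (b d)) \<le> liminf (\<lambda>d. ereal (f d / g d))"
    by (rule Liminf_mono) (use assms(1) in simp)
  moreover have "1 \<le> ereal l"
    using assms(3) by simp
  ultimately show ?thesis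
    unfolding asymp_ge_def by order
qed

text \<open>
  The choice \<open>z = B d\<close>, which is the right order of magnitude as long as \<open>k\<close> is at most of order
  \<open>d powr (1 - \<alpha>)\<close>: then \<open>k z powr \<alpha>\<close> is at most of order \<open>d\<close>.
\<close>

lemma q_L_ge_linear:
  assumes d: "1 \<le> d" and k: "k \<le> d" and \<alpha>: "0 \<le> \<alpha>" "\<alpha> < 1" and B: "B > 1"
  shows "(1 - 2 / B - B powr (\<alpha> - 1) * (real k / real d powr (1 - \<alpha>))) / (B * real d) \<le> q_L \<alpha> d k"
proof -
  have "1 * 1 < B * real d"
    using B d by (intro mult_less_le_imp_less) auto
  then have "(1 - (2 * real d + real k * (B * real d) powr \<alpha>) / (B * real d)) / (B * real d) \<le> q_L \<alpha> d k"
    using q_L_ge[OF d k \<alpha>, of "B * real d"] by simp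
  moreover have "(2 * real d + real k * (B * real d) powr \<alpha>) / (B * real d)
      = 2 / B + real k * (B * real d) powr (\<alpha> - 1)"
    using B d by (simp add: add_divide_distrib powr_diff)
  moreover have "(B * real d) powr (\<alpha> - 1) = B powr (\<alpha> - 1) * (1 / real d powr (1 - \<alpha>))"
    using B d by (simp add: powr_mult powr_minus_divide[symmetric])
  ultimately show ?thesis
    by (simp add: diff_diff_eq mult_ac)
qed

lemma asymp_q_L_linear:
  assumes \<phi>: "\<And>d. d \<ge> 1 \<Longrightarrow> \<phi> d \<le> d" and \<alpha>: "0 \<le> \<alpha>" "\<alpha> < 1"
    and lim: "(\<lambda>d. real (\<phi> d) / real d powr (1 - \<alpha>)) \<longlonglongrightarrow> c"
    and B: "B > 1" and C: "C > 0" "C * B \<le> 1 - 2 / B - B powr (\<alpha> - 1) * c"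
  shows "(\<lambda>d. q_L \<alpha> d (\<phi> d)) \<greatersim> (\<lambda>d. C * real d powr (-1))"
proof (rule asymp_geI)
  show "(\<lambda>d. (1 - 2 / B - B powr (\<alpha> - 1) * (real (\<phi> d) / real d powr (1 - \<alpha>))) / (C * B))
      \<longlonglongrightarrow> (1 - 2 / B - B powr (\<alpha> - 1) * c) / (C * B)"
    using B C(1) by (intro tendsto_intros lim) auto
  show "1 \<le> (1 - 2 / B - B powr (\<alpha> - 1) * c) / (C * B)"
    using B C by (simp add: le_divide_eq)
  show "eventually (\<lambda>d. (1 - 2 / B - B powr (\<alpha> - 1) * (real (\<phi> d) / real d powr (1 - \<alpha>))) / (C * B)
      \<le> q_L \<alpha> d (\<phi> d) / (C * real d powr (-1))) sequentially"
    using eventually_ge_at_top[of 1]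
  proof eventually_elim
    case (elim d)
    let ?N = "1 - 2 / B - B powr (\<alpha> - 1) * (real (\<phi> d) / real d powr (1 - \<alpha>))"
    have "?N / (C * B) = (?N / (B * real d)) / (C * real d powr (-1))"
      using elim B C by (simp add: powr_minus_divide)
    also have "\<dots> \<le> q_L \<alpha> d (\<phi> d) / (C * real d powr (-1))"
      by (intro divide_right_mono q_L_ge_linear[OF elim \<phi>[OF elim] \<alpha> B]) (use C in auto)
    finally show ?case .
  qed
qed

text \<open>
  Convexity of the exponential function: the two sides agree at the end points 0 and \<open>1 / 2\<close>.
\<close>

lemma quarter_powr_le:
  assumes "0 \<le> v" "v \<le> 1 / 2"
  shows "(1 / 4) powr v \<le> 1 - (v :: real)"
proof -
  have "exp ((1 - 2 * v) *\<^sub>R 0 + (2 * v) *\<^sub>R (- ln 2)) \<le> (1 - 2 * v) * exp 0 + (2 * v) * exp (- ln 2 :: real)"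
    by (rule convex_onD[OF exp_convex]) (use assms in auto)
  also have "\<dots> = 1 - v"
    by (simp add: exp_minus)
  also have "exp ((1 - 2 * v) *\<^sub>R 0 + (2 * v) *\<^sub>R (- ln 2)) = (1 / 4) powr v"
  proof -
    have "ln (1 / 4 :: real) = - 2 * ln 2"
      using ln_realpow[of 2 2] by (simp add: ln_div)
    then show ?thesis
      by (simp add: powr_def)
  qed
  finally show ?thesis .
qed

text \<open>
  With \<open>v = (1 - \<alpha>) / (2 - \<alpha>)\<close> the claim reduces to \<open>(1 - v) powr (1 / v) \<ge> 1 / 4\<close>, which holds with
  equality at \<open>v = 1 / 2\<close>, that is for \<open>\<alpha> = 0\<close>.
\<close>

lemma optimal_constant_ge:
  fixes \<alpha> :: real
  assumes "0 \<le> \<alpha>" "\<alpha> < 1"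
  shows "1 / 4 * (1 - \<alpha>) * (2 - \<alpha>) powr (1 / (1 - \<alpha>)) \<le> 1 - 1 / (2 - \<alpha>)"
proof -
  \<comment> \<open>This is the gap \<open>1 - 1 / B\<close> for \<open>B = 2 - \<alpha>\<close>.\<close>
  define v where "v = (1 - \<alpha>) / (2 - \<alpha>)"
  have v: "0 < v" "v \<le> 1 / 2" "1 - v = 1 / (2 - \<alpha>)"
    using assms by (auto simp: v_def field_simps)
  have "(1 / 4) powr v \<le> 1 - v"
    using v by (intro quarter_powr_le) auto
  then have "((1 / 4) powr v) powr (1 / v) \<le> (1 - v) powr (1 / v)"
    using v by (intro powr_mono2) auto
  then have quarter: "1 / 4 \<le> (1 / (2 - \<alpha>)) powr (1 / v)"
    using v by (simp add: powr_powr)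
  have inv: "1 / v = 1 + 1 / (1 - \<alpha>)"
    using assms by (simp add: v_def field_simps)
  have "(1 / (2 - \<alpha>)) powr (1 / v) * (2 - \<alpha>) powr (1 / (1 - \<alpha>)) = 1 / (2 - \<alpha>)"
    unfolding inv using assms by (simp add: powr_add powr_divide)
  moreover have "1 / 4 * (2 - \<alpha>) powr (1 / (1 - \<alpha>)) \<le> (1 / (2 - \<alpha>)) powr (1 / v) * (2 - \<alpha>) powr (1 / (1 - \<alpha>))"
    using quarter by (intro mult_right_mono) auto
  ultimately have "1 / 4 * (2 - \<alpha>) powr (1 / (1 - \<alpha>)) \<le> 1 / (2 - \<alpha>)"
    by simp
  then have "(1 - \<alpha>) * (1 / 4 * (2 - \<alpha>) powr (1 / (1 - \<alpha>))) \<le> (1 - \<alpha>) * (1 / (2 - \<alpha>))"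
    using assms by (intro mult_left_mono) auto
  also have "\<dots> = 1 - 1 / (2 - \<alpha>)"
    using assms by (simp add: field_simps)
  finally show ?thesis
    by (simp add: mult_ac)
qed

text \<open>
  The choice \<open>z = (B c d) powr (1 / (1 - \<alpha>))\<close> makes \<open>k z powr \<alpha> / z\<close> tend to \<open>1 / B\<close>, whereas \<open>d / z\<close>
  tends to 0 because \<open>\<alpha>\<close> is positive. The limiting bound is proportional to \<open>(1 - 1 / B) B powr (- 1 / (1 - \<alpha>))\<close>,
  which is largest at \<open>B = 2 - \<alpha>\<close>.
\<close>

lemma asymp_q_L_proportional:
  assumes \<phi>: "\<And>d. d \<ge> 1 \<Longrightarrow> \<phi> d \<le> d" and \<alpha>: "0 < \<alpha>" "\<alpha> < 1" and c: "0 < c"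
    and lim: "(\<lambda>d. real (\<phi> d)) \<sim>[at_top] (\<lambda>d. c * real d)"
  shows "(\<lambda>d. q_L \<alpha> d (\<phi> d)) \<greatersim> (\<lambda>d. 1 / 4 * (1 - \<alpha>) * (c * real d) powr (- 1 / (1 - \<alpha>)))"
proof (rule asymp_geI)
  define B where "B = 2 - \<alpha>"
  define \<beta> where "\<beta> = 1 / (1 - \<alpha>)"
  define K where "K = 1 / 4 * (1 - \<alpha>) * B powr \<beta>"
  define z where "z = (\<lambda>d. (B * (c * real d)) powr \<beta>)"
  have B: "1 < B" using \<alpha> by (simp add: B_def)
  have \<beta>: "1 < \<beta>" using \<alpha> by (simp add: \<beta>_def)
  have K: "0 < K" using \<alpha> B by (simp add: K_def)
  have \<beta>_eq: "\<beta> * (\<alpha> - 1) = -1" using \<alpha> by (simp add: \<beta>_def field_simps)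
  let ?N = "\<lambda>d. 1 - (2 * (B * c) powr - \<beta> * real d powr (1 - \<beta>) + (real (\<phi> d) / (c * real d)) / B)"
  let ?b = "\<lambda>d. ?N d / K"
  have "(\<lambda>d. if real (\<phi> d) = 0 \<and> c * real d = 0 then 1 else real (\<phi> d) / (c * real d)) \<longlonglongrightarrow> 1"
    using asymp_equivD[OF lim] by simp
  moreover have "eventually (\<lambda>d. (if real (\<phi> d) = 0 \<and> c * real d = 0 then 1 else real (\<phi> d) / (c * real d))
      = real (\<phi> d) / (c * real d)) sequentially"
    using eventually_gt_at_top[of 0] by eventually_elim (use c in auto)
  ultimately have ratio: "(\<lambda>d. real (\<phi> d) / (c * real d)) \<longlonglongrightarrow> 1"
    by (rule Lim_transform_eventually)
  have "(\<lambda>d. real d powr (1 - \<beta>)) \<longlonglongrightarrow> 0"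
    using \<beta> by (intro tendsto_neg_powr filterlim_real_sequentially) auto
  then show "?b \<longlonglongrightarrow> (1 - (2 * (B * c) powr - \<beta> * 0 + 1 / B)) / K"
    using ratio B K by (intro tendsto_intros) auto
  show "1 \<le> (1 - (2 * (B * c) powr - \<beta> * 0 + 1 / B)) / K"
    using optimal_constant_ge[of \<alpha>] \<alpha> K by (simp add: K_def B_def \<beta>_def le_divide_eq)
  have "filterlim (\<lambda>d. B * (c * real d)) at_top sequentially"
    using B c by (intro filterlim_tendsto_pos_mult_at_top[OF tendsto_const] filterlim_real_sequentially) auto
  then have "eventually (\<lambda>d. 1 < B * (c * real d)) sequentially"
    by (simp add: filterlim_at_top_dense)
  then show "eventually (\<lambda>d. ?b d \<le> q_L \<alpha> d (\<phi> d) / (1 / 4 * (1 - \<alpha>) * (c * real d) powr (- 1 / (1 - \<alpha>)))) sequentially"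
    using eventually_ge_at_top[of 1]
  proof eventually_elim
    case (elim d)
    have z1: "1 < z d"
      using elim \<beta> unfolding z_def by (intro gr_one_powr) auto
    have z\<alpha>: "z d powr \<alpha> / z d = 1 / (B * (c * real d))"
    proof -
      have "z d powr \<alpha> / z d = z d powr (\<alpha> - 1)"
        using z1 by (simp add: powr_diff)
      also have "\<dots> = (B * (c * real d)) powr (\<beta> * (\<alpha> - 1))"
        by (simp add: z_def powr_powr)
      finally show ?thesis
        unfolding \<beta>_eq using elim by (simp add: powr_minus_divide)
    qed
    have zd: "real d / z d = (B * c) powr - \<beta> * real d powr (1 - \<beta>)"
    proof -
      have "z d = (B * c) powr \<beta> * real d powr \<beta>"
        using B c by (simp add: z_def powr_mult mult.assoc[symmetric])
      then show ?thesis
        using elim by (simp add: powr_diff powr_minus_divide)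
    qed
    have "(1 - (2 * real d + real (\<phi> d) * z d powr \<alpha>) / z d) / z d \<le> q_L \<alpha> d (\<phi> d)"
      using q_L_ge[OF elim(2) \<phi>[OF elim(2)] _ \<alpha>(2) z1] \<alpha>(1) by simp
    moreover have "(2 * real d + real (\<phi> d) * z d powr \<alpha>) / z d = 2 * (real d / z d) + real (\<phi> d) * (z d powr \<alpha> / z d)"
      by (simp add: add_divide_distrib)
    ultimately have N: "?N d / z d \<le> q_L \<alpha> d (\<phi> d)"
      unfolding zd z\<alpha> by (simp add: mult_ac)
    let ?G = "1 / 4 * (1 - \<alpha>) * (c * real d) powr (- 1 / (1 - \<alpha>))"
    have "z d * ?G = K"
      using B c elim by (simp add: z_def K_def powr_mult powr_minus_divide \<beta>_def)
    then have "?N d / K = ?N d / z d / ?G"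
      by (simp only: divide_divide_eq_left)
    also have "\<dots> \<le> q_L \<alpha> d (\<phi> d) / ?G"
      by (rule divide_right_mono[OF N]) (use \<alpha> in auto)
    finally show ?case .
  qed
qed

theorem proposition3p2:
  shows "\<exists>C :: real \<Rightarrow> real \<Rightarrow> real.
    (\<forall>c\<in>{0..1}. \<forall>\<alpha>\<in>{0..<1}. C c \<alpha> > 0) \<and>
    (\<forall>\<phi> :: nat \<Rightarrow> nat. (\<forall>d\<ge>1. \<phi> d \<le> d) \<longrightarrow>
      (\<forall>\<alpha>\<in>{0..<1}.
         (\<lambda>d. real (\<phi> d)) \<in> o(\<lambda>d. real d powr (1 - \<alpha>)) \<longrightarrow>
         (\<lambda>d. q_L \<alpha> d (\<phi> d)) \<greatersim> (\<lambda>d. 1 / 8 * real d powr (-1))) \<and>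
      (\<forall>\<alpha>\<in>{0..<1}. \<forall>c\<in>{0..1}.
         (\<lambda>d. real (\<phi> d) / real d powr (1 - \<alpha>)) \<longlonglongrightarrow> c \<longrightarrow>
         (\<lambda>d. q_L \<alpha> d (\<phi> d)) \<greatersim> (\<lambda>d. C c \<alpha> * real d powr (-1))) \<and>
      (\<forall>c\<in>{0<..1}.
         (\<lambda>d. real (\<phi> d)) \<sim>[at_top] (\<lambda>d. c * real d) \<longrightarrow>
         (\<forall>\<alpha>\<in>{0<..<1}.
            (\<lambda>d. q_L \<alpha> d (\<phi> d)) \<greatersim>
            (\<lambda>d. 1 / 4 * (1 - \<alpha>) * (c * real d) powr (- 1 / (1 - \<alpha>))))))"
proof -
  \<comment> \<open>This slope makes \<open>2 / B + B powr (\<alpha> - 1) * c\<close> less than one half for all \<open>c \<le> 1\<close>.\<close>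
  define B :: "real \<Rightarrow> real" where "B = (\<lambda>\<alpha>. 8 powr (1 / (1 - \<alpha>)))"
  have B8: "8 \<le> B \<alpha>" if "\<alpha> \<in> {0..<1}" for \<alpha>
    using powr_mono[of 1 "1 / (1 - \<alpha>)" 8] that by (simp add: B_def)
  have B_powr: "B \<alpha> powr (\<alpha> - 1) = 1 / 8" if "\<alpha> \<in> {0..<1}" for \<alpha>
  proof -
    have "1 / (1 - \<alpha>) * (\<alpha> - 1) = -1"
      using that by (simp add: field_simps)
    then show ?thesis
      by (simp only: B_def powr_powr) (simp add: powr_minus_divide)
  qed
  show ?thesis
  proof (rule exI[of _ "\<lambda>c \<alpha>. 1 / (2 * B \<alpha>)"], intro conjI ballI allI impI)
    fix c \<alpha> :: real assume "\<alpha> \<in> {0..<1}"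
    then show "0 < 1 / (2 * B \<alpha>)"
      using B8[of \<alpha>] by simp
  next
    fix \<phi> :: "nat \<Rightarrow> nat" and \<alpha> :: real
    assume "\<forall>d\<ge>1. \<phi> d \<le> d" "\<alpha> \<in> {0..<1}" "(\<lambda>d. real (\<phi> d)) \<in> o(\<lambda>d. real d powr (1 - \<alpha>))"
    \<comment> \<open>For a negligible tilt the bound is \<open>(1 - 2 / B) / B\<close> times \<open>1 / d\<close>, largest at \<open>B = 4\<close>.\<close>
    then show "(\<lambda>d. q_L \<alpha> d (\<phi> d)) \<greatersim> (\<lambda>d. 1 / 8 * real d powr (-1))"
      by (intro asymp_q_L_linear[where B = 4 and c = 0] smalloD_tendsto) auto
  next
    fix \<phi> :: "nat \<Rightarrow> nat" and \<alpha> c :: real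
    assume *: "\<forall>d\<ge>1. \<phi> d \<le> d" "\<alpha> \<in> {0..<1}" "c \<in> {0..1}"
      "(\<lambda>d. real (\<phi> d) / real d powr (1 - \<alpha>)) \<longlonglongrightarrow> c"
    have "1 / (2 * B \<alpha>) * B \<alpha> \<le> 1 - 2 / B \<alpha> - B \<alpha> powr (\<alpha> - 1) * c"
    proof -
      have "2 / B \<alpha> \<le> 2 / 8"
        using B8[OF *(2)] by (intro divide_left_mono) auto
      moreover have "1 / (2 * B \<alpha>) * B \<alpha> = 1 / 2"
        using B8[OF *(2)] by simp
      ultimately show ?thesis
        unfolding B_powr[OF *(2)] using *(3) by simp
    qed
    then show "(\<lambda>d. q_L \<alpha> d (\<phi> d)) \<greatersim> (\<lambda>d. 1 / (2 * B \<alpha>) * real d powr (-1))"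
      using * B8[OF *(2)] by (intro asymp_q_L_linear[where B = "B \<alpha>" and c = c]) auto
  next
    fix \<phi> :: "nat \<Rightarrow> nat" and c \<alpha> :: real
    assume "\<forall>d\<ge>1. \<phi> d \<le> d" "c \<in> {0<..1}" "(\<lambda>d. real (\<phi> d)) \<sim>[at_top] (\<lambda>d. c * real d)" "\<alpha> \<in> {0<..<1}"
    then show "(\<lambda>d. q_L \<alpha> d (\<phi> d)) \<greatersim> (\<lambda>d. 1 / 4 * (1 - \<alpha>) * (c * real d) powr (- 1 / (1 - \<alpha>)))"
      by (intro asymp_q_L_proportional) auto
  qed
qed

end
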